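(* Let $(M,\alpha_M)$ and $(N,\alpha_N)$ be perfect Hom-Lie algebras with compatible Hom-actions on each other such that ${}^NM=M$ and ${}^MN=N$. Then $(M\star N,\alpha_{M\star N})$ is a perfect Hom-Lie algebra as well.
   Context: Fix a ground field $\mathbb K$; all vector spaces and (bi)linear maps are over $\mathbb K$. A Hom-Lie algebra $(L,\alpha_L)$ is a vector space $L$ with a bilinear bracket and a linear map $\alpha_L:L\to L$ such that $[x,y]=-[y,x]$ and $[\alpha_L(x),[y,z]]+[\alpha_L(z),[x,y]]+[\alpha_L(y),[z,x]]=0$; all Hom-Lie algebras are assumed multiplicative: $\alpha_L[x,y]=[\alpha_L(x),\alpha_L(y)]$. $(L,\alpha_L)$ is perfect if $L=[L,L]$, the span of all brackets. A Hom-action of $(L,\alpha_L)$ on $(M,\alpha_M)$ is a linear map $L\otimes M\to M$, $x\otimes m\mapsto {}^xm$, with ${}^{[x,y]}\alpha_M(m)={}^{\alpha_L(x)}({}^ym)-{}^{\alpha_L(y)}({}^xm)$, ${}^{\alpha_L(x)}[m,m']=[{}^xm,\alpha_M(m')]+[\alpha_M(m),{}^xm']$, $\alpha_M({}^xm)={}^{\alpha_L(x)}\alpha_M(m)$. Mutual Hom-actions of $(M,\alpha_M)$ and $(N,\alpha_N)$ are compatible if ${}^{({}^mn)}m'=[m',{}^nm]$ and ${}^{({}^nm)}n'=[n',{}^mn]$ for all $m,m'\in M$, $n,n'\in N$. ${}^NM$ (resp. ${}^MN$) is the subspace of $M$ (resp. $N$) spanned by all ${}^nm$ (resp. ${}^mn$).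 For compatible mutual Hom-actions, the non-abelian tensor product $(M\star N,\alpha_{M\star N})$ is the quotient of the vector space $M\otimes N$ by the subspace spanned by all elements: (i) $[m,m']\otimes\alpha_N(n)-\alpha_M(m)\otimes{}^{m'}n+\alpha_M(m')\otimes{}^mn$; (ii) $\alpha_M(m)\otimes[n,n']-{}^{n'}m\otimes\alpha_N(n)+{}^nm\otimes\alpha_N(n')$; (iii) ${}^nm\otimes{}^mn$; (iv) ${}^nm\otimes{}^{m'}n'+{}^{n'}m'\otimes{}^mn$; (v) $[{}^nm,{}^{n'}m']\otimes\alpha_N({}^{m''}n'')+[{}^{n'}m',{}^{n''}m'']\otimes\alpha_N({}^mn)+[{}^{n''}m'',{}^nm]\otimes\alpha_N({}^{m'}n')$. The class of $m\otimes n$ is $m\star n$; the bracket is $[m\star n,m'\star n']=-{}^nm\star{}^{m'}n'$, and $\alpha_{M\star N}(m\star n)=\alpha_M(m)\star\alpha_N(n)$.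
   Formalization: The formal statement adds the assumption that the ground field has characteristic other than 2, or that [x,x]=0 holds in both M and N; without it the bracket on the tensor product can be ill-defined in characteristic 2. *)

theory Defs
  imports "HOL-Algebra.Module" "HOL-Algebra.AbelCoset"
begin

section \<open>Linear algebra over a field\<close>

text \<open>
  A vector space over a field \<open>K\<close> is a structure \<open>V\<close> with \<open>field K\<close> and \<open>module K V\<close>.
  The record type of modules extends that of rings; the ring multiplication and the ring unit
  of a module have no meaning and are left \<open>undefined\<close> in the constructions below.
\<close>

definition linear_map ::
    "('k, 'z) ring_scheme \<Rightarrow> ('k, 'v, 'p) module_scheme \<Rightarrow> ('k, 'w, 'q) module_scheme
      \<Rightarrow> ('v \<Rightarrow> 'w) \<Rightarrow> bool" where
  "linear_map K V W f \<longleftrightarrow>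
     f \<in> carrier V \<rightarrow> carrier W \<and>
     (\<forall>x\<in>carrier V. \<forall>y\<in>carrier V. f (x \<oplus>\<^bsub>V\<^esub> y) = f x \<oplus>\<^bsub>W\<^esub> f y) \<and>
     (\<forall>c\<in>carrier K. \<forall>x\<in>carrier V. f (c \<odot>\<^bsub>V\<^esub> x) = c \<odot>\<^bsub>W\<^esub> f x)"

definition bilinear_map ::
    "('k, 'z) ring_scheme \<Rightarrow> ('k, 'u, 'o) module_scheme \<Rightarrow> ('k, 'v, 'p) module_scheme
      \<Rightarrow> ('k, 'w, 'q) module_scheme \<Rightarrow> ('u \<Rightarrow> 'v \<Rightarrow> 'w) \<Rightarrow> bool" where
  "bilinear_map K U V W b \<longleftrightarrow>
     (\<forall>x\<in>carrier U. linear_map K V W (b x)) \<and>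
     (\<forall>y\<in>carrier V. linear_map K U W (\<lambda>x. b x y))"

definition lin_span ::
    "('k, 'z) ring_scheme \<Rightarrow> ('k, 'v, 'p) module_scheme \<Rightarrow> 'v set \<Rightarrow> 'v set" where
  "lin_span K V S = \<Inter>{H. submodule H K V \<and> S \<subseteq> H}"

text \<open>
  The quotient of \<open>V\<close> by a subspace \<open>W\<close>; its elements are the cosets \<open>W +>\<^bsub>V\<^esub> x\<close>.
\<close>

definition quotient_space ::
    "('k, 'v, 'p) module_scheme \<Rightarrow> 'v set \<Rightarrow> ('k, 'v set) module" where
  "quotient_space V W =
     \<lparr>carrier = a_rcosets\<^bsub>V\<^esub> W, mult = undefined, one = undefined,
      zero = W, add = set_add V,
      smult = (\<lambda>c X. \<Union>x\<in>X. W +>\<^bsub>V\<^esub> (c \<odot>\<^bsub>V\<^esub> x))\<rparr>"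

text \<open>The vector space with basis \<open>X\<close>: finitely supported functions \<open>X \<rightarrow> K\<close>, extended by zero.\<close>

definition free_space :: "('k, 'z) ring_scheme \<Rightarrow> 'x set \<Rightarrow> ('k, 'x \<Rightarrow> 'k) module" where
  "free_space K X =
     \<lparr>carrier = {f. range f \<subseteq> carrier K \<and> finite {x. f x \<noteq> \<zero>\<^bsub>K\<^esub>} \<and> {x. f x \<noteq> \<zero>\<^bsub>K\<^esub>} \<subseteq> X},
      mult = undefined, one = undefined,
      zero = (\<lambda>x. \<zero>\<^bsub>K\<^esub>), add = (\<lambda>f g x. f x \<oplus>\<^bsub>K\<^esub> g x),
      smult = (\<lambda>c f x. c \<otimes>\<^bsub>K\<^esub> f x)\<rparr>"

definition basis_vec :: "('k, 'z) ring_scheme \<Rightarrow> 'x \<Rightarrow> 'x \<Rightarrow> 'k" where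
  "basis_vec K x = (\<lambda>y. if y = x then \<one>\<^bsub>K\<^esub> else \<zero>\<^bsub>K\<^esub>)"

definition tensor_relations ::
    "('k, 'z) ring_scheme \<Rightarrow> ('k, 'u, 'o) module_scheme \<Rightarrow> ('k, 'v, 'p) module_scheme
      \<Rightarrow> ('u \<times> 'v \<Rightarrow> 'k) set" where
  "tensor_relations K U V =
     (let F = free_space K (carrier U \<times> carrier V); e = (\<lambda>x y. basis_vec K (x, y)) in
      {e (x \<oplus>\<^bsub>U\<^esub> x') y \<ominus>\<^bsub>F\<^esub> (e x y \<oplus>\<^bsub>F\<^esub> e x' y) | x x' y.
         x \<in> carrier U \<and> x' \<in> carrier U \<and> y \<in> carrier V} \<union>
      {e x (y \<oplus>\<^bsub>V\<^esub> y') \<ominus>\<^bsub>F\<^esub> (e x y \<oplus>\<^bsub>F\<^esub> e x y') | x y y'.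
         x \<in> carrier U \<and> y \<in> carrier V \<and> y' \<in> carrier V} \<union>
      {e (c \<odot>\<^bsub>U\<^esub> x) y \<ominus>\<^bsub>F\<^esub> c \<odot>\<^bsub>F\<^esub> e x y | c x y.
         c \<in> carrier K \<and> x \<in> carrier U \<and> y \<in> carrier V} \<union>
      {e x (c \<odot>\<^bsub>V\<^esub> y) \<ominus>\<^bsub>F\<^esub> c \<odot>\<^bsub>F\<^esub> e x y | c x y.
         c \<in> carrier K \<and> x \<in> carrier U \<and> y \<in> carrier V})"

definition tensor_space ::
    "('k, 'z) ring_scheme \<Rightarrow> ('k, 'u, 'o) module_scheme \<Rightarrow> ('k, 'v, 'p) module_scheme
      \<Rightarrow> ('k, ('u \<times> 'v \<Rightarrow> 'k) set) module" where
  "tensor_space K U V =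
     (let F = free_space K (carrier U \<times> carrier V)
      in quotient_space F (lin_span K F (tensor_relations K U V)))"

definition pure_tensor ::
    "('k, 'z) ring_scheme \<Rightarrow> ('k, 'u, 'o) module_scheme \<Rightarrow> ('k, 'v, 'p) module_scheme
      \<Rightarrow> 'u \<Rightarrow> 'v \<Rightarrow> ('u \<times> 'v \<Rightarrow> 'k) set" where
  "pure_tensor K U V x y =
     (let F = free_space K (carrier U \<times> carrier V)
      in lin_span K F (tensor_relations K U V) +>\<^bsub>F\<^esub> basis_vec K (x, y))"


section \<open>Hom-Lie algebras\<close>

record ('k, 'v) hom_lie = "('k, 'v) module" +
  bracket :: "'v \<Rightarrow> 'v \<Rightarrow> 'v" ("\<lbrakk>_, _\<rbrakk>\<index>")
  twist :: "'v \<Rightarrow> 'v"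

text \<open>
  In characteristic 2 the axiom \<open>skew\<close> below does not imply \<open>\<lbrakk>x, x\<rbrakk> = \<zero>\<close>.
\<close>

locale hom_lie_algebra = field K + module K L
  for K :: "('k, 'z) ring_scheme" (structure)
  and L :: "('k, 'v, 'p) hom_lie_scheme" (structure) +
  assumes bracket_bilinear: "bilinear_map K L L L (bracket L)"
    and twist_linear: "linear_map K L L (twist L)"
    and skew: "\<lbrakk>x \<in> carrier L; y \<in> carrier L\<rbrakk> \<Longrightarrow> \<lbrakk>x, y\<rbrakk>\<^bsub>L\<^esub> = \<ominus>\<^bsub>L\<^esub> \<lbrakk>y, x\<rbrakk>\<^bsub>L\<^esub>"
    and hom_jacobi: "\<lbrakk>x \<in> carrier L; y \<in> carrier L; z \<in> carrier L\<rbrakk> \<Longrightarrow>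
        \<lbrakk>twist L x, \<lbrakk>y, z\<rbrakk>\<^bsub>L\<^esub>\<rbrakk>\<^bsub>L\<^esub> \<oplus>\<^bsub>L\<^esub> \<lbrakk>twist L z, \<lbrakk>x, y\<rbrakk>\<^bsub>L\<^esub>\<rbrakk>\<^bsub>L\<^esub> \<oplus>\<^bsub>L\<^esub> \<lbrakk>twist L y, \<lbrakk>z, x\<rbrakk>\<^bsub>L\<^esub>\<rbrakk>\<^bsub>L\<^esub> = \<zero>\<^bsub>L\<^esub>"
    and multiplicative: "\<lbrakk>x \<in> carrier L; y \<in> carrier L\<rbrakk> \<Longrightarrow>
        twist L \<lbrakk>x, y\<rbrakk>\<^bsub>L\<^esub> = \<lbrakk>twist L x, twist L y\<rbrakk>\<^bsub>L\<^esub>"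

definition perfect :: "('k, 'z) ring_scheme \<Rightarrow> ('k, 'v, 'p) hom_lie_scheme \<Rightarrow> bool" where
  "perfect K L \<longleftrightarrow>
     lin_span K L {\<lbrakk>x, y\<rbrakk>\<^bsub>L\<^esub> | x y. x \<in> carrier L \<and> y \<in> carrier L} = carrier L"

definition hom_action ::
    "('k, 'z) ring_scheme \<Rightarrow> ('k, 'l, 'p) hom_lie_scheme \<Rightarrow> ('k, 'm, 'q) hom_lie_scheme
      \<Rightarrow> ('l \<Rightarrow> 'm \<Rightarrow> 'm) \<Rightarrow> bool" where
  "hom_action K L M act \<longleftrightarrow>
     bilinear_map K L M M act \<and>
     (\<forall>x\<in>carrier L. \<forall>y\<in>carrier L. \<forall>m\<in>carrier M.
        act \<lbrakk>x, y\<rbrakk>\<^bsub>L\<^esub> (twist M m)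
          = act (twist L x) (act y m) \<ominus>\<^bsub>M\<^esub> act (twist L y) (act x m)) \<and>
     (\<forall>x\<in>carrier L. \<forall>m\<in>carrier M. \<forall>m'\<in>carrier M.
        act (twist L x) \<lbrakk>m, m'\<rbrakk>\<^bsub>M\<^esub>
          = \<lbrakk>act x m, twist M m'\<rbrakk>\<^bsub>M\<^esub> \<oplus>\<^bsub>M\<^esub> \<lbrakk>twist M m, act x m'\<rbrakk>\<^bsub>M\<^esub>) \<and>
     (\<forall>x\<in>carrier L. \<forall>m\<in>carrier M.
        twist M (act x m) = act (twist L x) (twist M m))"

text \<open>
  From here on, \<open>aM m n\<close> is the action of \<open>m \<in> M\<close> on \<open>n \<in> N\<close> (written \<open>\<^sup>mn\<close> on paper), and
  \<open>aN n m\<close> is the action of \<open>n \<in> N\<close> on \<open>m \<in> M\<close>.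
\<close>

definition compatible_actions ::
    "('k, 'm, 'p) hom_lie_scheme \<Rightarrow> ('k, 'n, 'q) hom_lie_scheme
      \<Rightarrow> ('m \<Rightarrow> 'n \<Rightarrow> 'n) \<Rightarrow> ('n \<Rightarrow> 'm \<Rightarrow> 'm) \<Rightarrow> bool" where
  "compatible_actions M N aM aN \<longleftrightarrow>
     (\<forall>m\<in>carrier M. \<forall>m'\<in>carrier M. \<forall>n\<in>carrier N.
        aN (aM m n) m' = \<lbrakk>m', aN n m\<rbrakk>\<^bsub>M\<^esub>) \<and>
     (\<forall>m\<in>carrier M. \<forall>n\<in>carrier N. \<forall>n'\<in>carrier N.
        aM (aN n m) n' = \<lbrakk>n', aM m n\<rbrakk>\<^bsub>N\<^esub>)"

definition action_span ::
    "('k, 'z) ring_scheme \<Rightarrow> ('k, 'l, 'p) hom_lie_scheme \<Rightarrow> ('k, 'm, 'q) hom_lie_scheme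
      \<Rightarrow> ('l \<Rightarrow> 'm \<Rightarrow> 'm) \<Rightarrow> 'm set" where
  "action_span K L M act = lin_span K M {act x m | x m. x \<in> carrier L \<and> m \<in> carrier M}"


section \<open>The non-abelian tensor product\<close>

definition star_relations ::
    "('k, 'z) ring_scheme \<Rightarrow> ('k, 'm, 'p) hom_lie_scheme \<Rightarrow> ('k, 'n, 'q) hom_lie_scheme
      \<Rightarrow> ('m \<Rightarrow> 'n \<Rightarrow> 'n) \<Rightarrow> ('n \<Rightarrow> 'm \<Rightarrow> 'm) \<Rightarrow> ('m \<times> 'n \<Rightarrow> 'k) set set" where
  "star_relations K M N aM aN =
     (let T = tensor_space K M N; t = pure_tensor K M N in
      {t \<lbrakk>m, m'\<rbrakk>\<^bsub>M\<^esub> (twist N n) \<ominus>\<^bsub>T\<^esub> t (twist M m) (aM m' n) \<oplus>\<^bsub>T\<^esub> t (twist M m') (aM m n) | m m' n.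
         m \<in> carrier M \<and> m' \<in> carrier M \<and> n \<in> carrier N} \<union>
      {t (twist M m) \<lbrakk>n, n'\<rbrakk>\<^bsub>N\<^esub> \<ominus>\<^bsub>T\<^esub> t (aN n' m) (twist N n) \<oplus>\<^bsub>T\<^esub> t (aN n m) (twist N n') | m n n'.
         m \<in> carrier M \<and> n \<in> carrier N \<and> n' \<in> carrier N} \<union>
      {t (aN n m) (aM m n) | m n. m \<in> carrier M \<and> n \<in> carrier N} \<union>
      {t (aN n m) (aM m' n') \<oplus>\<^bsub>T\<^esub> t (aN n' m') (aM m n) | m m' n n'.
         m \<in> carrier M \<and> m' \<in> carrier M \<and> n \<in> carrier N \<and> n' \<in> carrier N} \<union>
      {t \<lbrakk>aN n m, aN n' m'\<rbrakk>\<^bsub>M\<^esub> (twist N (aM m'' n''))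
         \<oplus>\<^bsub>T\<^esub> t \<lbrakk>aN n' m', aN n'' m''\<rbrakk>\<^bsub>M\<^esub> (twist N (aM m n))
         \<oplus>\<^bsub>T\<^esub> t \<lbrakk>aN n'' m'', aN n m\<rbrakk>\<^bsub>M\<^esub> (twist N (aM m' n')) | m m' m'' n n' n''.
         m \<in> carrier M \<and> m' \<in> carrier M \<and> m'' \<in> carrier M \<and>
         n \<in> carrier N \<and> n' \<in> carrier N \<and> n'' \<in> carrier N})"

definition star_space ::
    "('k, 'z) ring_scheme \<Rightarrow> ('k, 'm, 'p) hom_lie_scheme \<Rightarrow> ('k, 'n, 'q) hom_lie_scheme
      \<Rightarrow> ('m \<Rightarrow> 'n \<Rightarrow> 'n) \<Rightarrow> ('n \<Rightarrow> 'm \<Rightarrow> 'm) \<Rightarrow> ('k, ('m \<times> 'n \<Rightarrow> 'k) set set) module" where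
  "star_space K M N aM aN =
     (let T = tensor_space K M N
      in quotient_space T (lin_span K T (star_relations K M N aM aN)))"

definition star ::
    "('k, 'z) ring_scheme \<Rightarrow> ('k, 'm, 'p) hom_lie_scheme \<Rightarrow> ('k, 'n, 'q) hom_lie_scheme
      \<Rightarrow> ('m \<Rightarrow> 'n \<Rightarrow> 'n) \<Rightarrow> ('n \<Rightarrow> 'm \<Rightarrow> 'm) \<Rightarrow> 'm \<Rightarrow> 'n \<Rightarrow> ('m \<times> 'n \<Rightarrow> 'k) set set" where
  "star K M N aM aN m n =
     (let T = tensor_space K M N
      in lin_span K T (star_relations K M N aM aN) +>\<^bsub>T\<^esub> pure_tensor K M N m n)"

text \<open>
  The bracket and the twisting map of the non-abelian tensor product are the bilinear and the
  linear map with prescribed values on the elements \<open>m \<star> n\<close>. These elements span, so there is at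
  most one such map up to values outside the carrier. That there is one at all, i.e. that the
  prescription is well defined, is not built in: without it the chosen operations are arbitrary.
  It can fail in characteristic 2 when \<open>\<lbrakk>x, x\<rbrakk> = \<zero>\<close> fails: let \<open>M = N\<close> have basis \<open>e, f\<close> with
  \<open>\<lbrakk>e, e\<rbrakk> = e\<close>, \<open>\<lbrakk>f, f\<rbrakk> = f\<close>, \<open>\<lbrakk>e, f\<rbrakk> = \<lbrakk>f, e\<rbrakk> = \<zero>\<close>, zero twisting map, and act on itself by the
  bracket. Then \<open>e \<star> e = \<zero>\<close>, while the bracket of \<open>e \<star> e\<close> and \<open>f \<star> f\<close> would be \<open>e \<star> f \<noteq> \<zero>\<close>.
\<close>

definition star_bracket ::
    "('k, 'z) ring_scheme \<Rightarrow> ('k, 'm, 'p) hom_lie_scheme \<Rightarrow> ('k, 'n, 'q) hom_lie_scheme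
      \<Rightarrow> ('m \<Rightarrow> 'n \<Rightarrow> 'n) \<Rightarrow> ('n \<Rightarrow> 'm \<Rightarrow> 'm)
      \<Rightarrow> ('m \<times> 'n \<Rightarrow> 'k) set set \<Rightarrow> ('m \<times> 'n \<Rightarrow> 'k) set set \<Rightarrow> ('m \<times> 'n \<Rightarrow> 'k) set set" where
  "star_bracket K M N aM aN =
     (let Q = star_space K M N aM aN; s = star K M N aM aN in
      SOME b. bilinear_map K Q Q Q b \<and>
        (\<forall>m\<in>carrier M. \<forall>n\<in>carrier N. \<forall>m'\<in>carrier M. \<forall>n'\<in>carrier N.
           b (s m n) (s m' n') = \<ominus>\<^bsub>Q\<^esub> s (aN n m) (aM m' n')))"

definition star_twist ::
    "('k, 'z) ring_scheme \<Rightarrow> ('k, 'm, 'p) hom_lie_scheme \<Rightarrow> ('k, 'n, 'q) hom_lie_scheme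
      \<Rightarrow> ('m \<Rightarrow> 'n \<Rightarrow> 'n) \<Rightarrow> ('n \<Rightarrow> 'm \<Rightarrow> 'm)
      \<Rightarrow> ('m \<times> 'n \<Rightarrow> 'k) set set \<Rightarrow> ('m \<times> 'n \<Rightarrow> 'k) set set" where
  "star_twist K M N aM aN =
     (let Q = star_space K M N aM aN; s = star K M N aM aN in
      SOME f. linear_map K Q Q f \<and>
        (\<forall>m\<in>carrier M. \<forall>n\<in>carrier N. f (s m n) = s (twist M m) (twist N n)))"

definition star_product ::
    "('k, 'z) ring_scheme \<Rightarrow> ('k, 'm, 'p) hom_lie_scheme \<Rightarrow> ('k, 'n, 'q) hom_lie_scheme
      \<Rightarrow> ('m \<Rightarrow> 'n \<Rightarrow> 'n) \<Rightarrow> ('n \<Rightarrow> 'm \<Rightarrow> 'm) \<Rightarrow> ('k, ('m \<times> 'n \<Rightarrow> 'k) set set) hom_lie" where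
  "star_product K M N aM aN =
     (let Q = star_space K M N aM aN in
      \<lparr>carrier = carrier Q, mult = undefined, one = undefined,
       zero = zero Q, add = add Q, smult = smult Q,
       bracket = star_bracket K M N aM aN, twist = star_twist K M N aM aN\<rparr>)"

end

theory Submission
  imports Defs
begin

text \<open>
  By compatibility and the axioms of a Hom-action, \<open>m \<otimes> n \<mapsto> \<^sup>nm\<close> and \<open>m \<otimes> n \<mapsto> \<^sup>mn\<close> kill the defining
  relations of \<open>M \<star> N\<close>; for relation (iii) this is \<open>\<lbrakk>x, x\<rbrakk> = \<zero>\<close>, and for relation (v) it is the
  Hom-Jacobi identity. They therefore descend to linear maps \<open>\<lambda>\<close> and \<open>\<mu>\<close> on \<open>M \<star> N\<close>, and the bracket is
  \<open>\<lbrakk>x, y\<rbrakk> = - \<lambda> x \<star> \<mu> y\<close>. Skew-symmetry and the Hom-Jacobi identity are multilinear, and on elements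
  \<open>m \<star> n\<close> they are relations (iv) and (v). The elements \<open>\<^sup>nm \<star> \<^sup>m'n' = - \<lbrakk>m \<star> n, m' \<star> n'\<rbrakk>\<close> span
  \<open>M \<star> N\<close> because \<open>\<^sup>NM = M\<close> and \<open>\<^sup>MN = N\<close>, hence perfectness.
\<close>

section \<open>Linear and bilinear maps\<close>

lemma linear_mapI:
  assumes "\<And>x. x \<in> carrier V \<Longrightarrow> f x \<in> carrier W"
    and "\<And>x y. \<lbrakk>x \<in> carrier V; y \<in> carrier V\<rbrakk> \<Longrightarrow> f (x \<oplus>\<^bsub>V\<^esub> y) = f x \<oplus>\<^bsub>W\<^esub> f y"
    and "\<And>c x. \<lbrakk>c \<in> carrier K; x \<in> carrier V\<rbrakk> \<Longrightarrow> f (c \<odot>\<^bsub>V\<^esub> x) = c \<odot>\<^bsub>W\<^esub> f x"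
  shows "linear_map K V W f"
  using assms by (simp add: linear_map_def)

lemma linear_mapD:
  assumes "linear_map K V W f"
  shows linear_map_closed: "x \<in> carrier V \<Longrightarrow> f x \<in> carrier W"
    and linear_map_add:
      "\<lbrakk>x \<in> carrier V; y \<in> carrier V\<rbrakk> \<Longrightarrow> f (x \<oplus>\<^bsub>V\<^esub> y) = f x \<oplus>\<^bsub>W\<^esub> f y"
    and linear_map_smult:
      "\<lbrakk>c \<in> carrier K; x \<in> carrier V\<rbrakk> \<Longrightarrow> f (c \<odot>\<^bsub>V\<^esub> x) = c \<odot>\<^bsub>W\<^esub> f x"
  using assms by (auto simp: linear_map_def)

lemma linear_map_zero:
  assumes V: "module K V" and W: "module K W" and f: "linear_map K V W f"
  shows "f \<zero>\<^bsub>V\<^esub> = \<zero>\<^bsub>W\<^esub>"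
proof -
  interpret V: module K V by (fact V)
  interpret W: module K W by (fact W)
  show ?thesis
    using linear_map_smult[OF f, of "\<zero>\<^bsub>K\<^esub>" "\<zero>\<^bsub>V\<^esub>"] linear_map_closed[OF f, of "\<zero>\<^bsub>V\<^esub>"] by simp
qed

lemma linear_map_minus:
  assumes V: "module K V" and W: "module K W" and f: "linear_map K V W f" and x: "x \<in> carrier V"
  shows "f (\<ominus>\<^bsub>V\<^esub> x) = \<ominus>\<^bsub>W\<^esub> f x"
proof -
  interpret V: module K V by (fact V)
  interpret W: module K W by (fact W)
  have "f (\<ominus>\<^bsub>V\<^esub> x) = f ((\<ominus>\<^bsub>K\<^esub> \<one>\<^bsub>K\<^esub>) \<odot>\<^bsub>V\<^esub> x)"
    using x by (simp add: V.smult_l_minus)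
  also have "\<dots> = \<ominus>\<^bsub>W\<^esub> f x"
    using x linear_map_closed[OF f x] by (simp add: linear_map_smult[OF f] W.smult_l_minus)
  finally show ?thesis .
qed

lemma linear_map_diff:
  assumes V: "module K V" and W: "module K W" and f: "linear_map K V W f"
    and x: "x \<in> carrier V" and y: "y \<in> carrier V"
  shows "f (x \<ominus>\<^bsub>V\<^esub> y) = f x \<ominus>\<^bsub>W\<^esub> f y"
proof -
  interpret V: module K V by (fact V)
  show ?thesis
    using x y by (simp add: a_minus_def linear_map_add[OF f] linear_map_minus[OF V W f])
qed

lemma linear_map_compose:
  assumes "linear_map K U V f" and "linear_map K V W g"
  shows "linear_map K U W (\<lambda>x. g (f x))"
  using assms by (auto simp: linear_map_def Pi_iff)

lemma linear_map_sum:
  assumes W: "module K W" and f: "linear_map K V W f" and g: "linear_map K V W g"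
  shows "linear_map K V W (\<lambda>x. f x \<oplus>\<^bsub>W\<^esub> g x)"
proof -
  interpret W: module K W by (fact W)
  show ?thesis
    by (rule linear_mapI) (use f g in \<open>auto simp: linear_mapD W.a_ac W.smult_r_distr\<close>)
qed

lemma linear_map_uminus:
  assumes W: "module K W" and f: "linear_map K V W f"
  shows "linear_map K V W (\<lambda>x. \<ominus>\<^bsub>W\<^esub> f x)"
proof -
  interpret W: module K W by (fact W)
  show ?thesis
    by (rule linear_mapI) (use f in \<open>auto simp: linear_mapD W.minus_add W.smult_r_minus\<close>)
qed

lemma linear_map_const_zero:
  assumes W: "module K W"
  shows "linear_map K V W (\<lambda>x. \<zero>\<^bsub>W\<^esub>)"
proof -
  interpret W: module K W by (fact W)
  show ?thesis by (rule linear_mapI) auto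
qed

lemma bilinear_mapD:
  assumes "bilinear_map K U V W b"
  shows bilinear_map_right: "x \<in> carrier U \<Longrightarrow> linear_map K V W (b x)"
    and bilinear_map_left: "y \<in> carrier V \<Longrightarrow> linear_map K U W (\<lambda>x. b x y)"
  using assms by (auto simp: bilinear_map_def)

lemma bilinear_map_closed:
  "\<lbrakk>bilinear_map K U V W b; x \<in> carrier U; y \<in> carrier V\<rbrakk> \<Longrightarrow> b x y \<in> carrier W"
  by (meson bilinear_map_right linear_map_closed)

text \<open>Applied to \<open>star\<close>, this yields the bracket of the tensor product up to
  sign, and also the bilinear map from which its twisting map is built.\<close>

lemma bilinear_map_compose:
  assumes "bilinear_map K U V W b" and "linear_map K U' U f" and "linear_map K V' V g"
  shows "bilinear_map K U' V' W (\<lambda>x y. b (f x) (g y))"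
  unfolding bilinear_map_def
  using linear_map_compose[OF assms(2) bilinear_map_left[OF assms(1)]]
    linear_map_compose[OF assms(3) bilinear_map_right[OF assms(1)]]
    linear_map_closed[OF assms(2)] linear_map_closed[OF assms(3)]
  by blast

lemma linear_map_bilinear_map:
  assumes "linear_map K W Z f" and "bilinear_map K U V W b"
  shows "bilinear_map K U V Z (\<lambda>x y. f (b x y))"
  unfolding bilinear_map_def
  using linear_map_compose[OF bilinear_map_left[OF assms(2)] assms(1)]
    linear_map_compose[OF bilinear_map_right[OF assms(2)] assms(1)] by blast

lemma bilinear_map_flip:
  "bilinear_map K U V W b \<Longrightarrow> bilinear_map K V U W (\<lambda>y x. b x y)"
  by (auto simp: bilinear_map_def)

section \<open>Spans\<close>

lemma lin_span_superset: "S \<subseteq> lin_span K V S"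
  by (auto simp: lin_span_def)

lemma lin_span_minimal: "\<lbrakk>submodule H K V; S \<subseteq> H\<rbrakk> \<Longrightarrow> lin_span K V S \<subseteq> H"
  by (auto simp: lin_span_def)

text \<open>The hypothesis on \<open>S\<close> puts the carrier itself into the family that is
  intersected. For any other \<open>S\<close> that family is empty and the span would be
  \<open>UNIV\<close>.\<close>

lemma lin_span_submodule:
  assumes V: "module K V" and S: "S \<subseteq> carrier V"
  shows "submodule (lin_span K V S) K V"
proof -
  interpret V: module K V by (fact V)
  show ?thesis
    by (rule V.submoduleI)
      (use V.carrier_is_submodule S in \<open>auto simp: lin_span_def V.submoduleE
        intro: subgroup.one_closed[of _ "add_monoid V", simplified] submodule.axioms(1)
        dest: V.submoduleE\<close>)
qed

lemma submodule_zero_closed: "submodule H K V \<Longrightarrow> \<zero>\<^bsub>V\<^esub> \<in> H"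
  using subgroup.one_closed[of H "add_monoid V"] submodule.axioms(1)[of H K V] by simp

lemma submodule_zero:
  assumes "module K V"
  shows "submodule {\<zero>\<^bsub>V\<^esub>} K V"
proof -
  interpret V: module K V by (fact assms)
  show ?thesis by (rule V.submoduleI) auto
qed

lemma submodule_vimage:
  assumes V: "module K V" and W: "module K W" and f: "linear_map K V W f"
    and H: "submodule H K W"
  shows "submodule {x \<in> carrier V. f x \<in> H} K V"
proof -
  interpret V: module K V by (fact V)
  interpret W: module K W by (fact W)
  show ?thesis
    by (rule V.submoduleI)
      (use f in \<open>auto simp: linear_mapD linear_map_minus[OF V W] linear_map_zero[OF V W]
        submodule_zero_closed[OF H] W.submoduleE[OF H]\<close>)
qed

text \<open>The preimage of \<open>H\<close> is a submodule containing \<open>S\<close>, hence it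
  contains the span of \<open>S\<close>. All later arguments on generators go back to this.\<close>

lemma linear_map_span_into:
  assumes "module K V" and "module K W" and f: "linear_map K V W f"
    and H: "submodule H K W" and S: "S \<subseteq> carrier V" "\<And>x. x \<in> S \<Longrightarrow> f x \<in> H"
    and x: "x \<in> lin_span K V S"
  shows "f x \<in> H"
  using lin_span_minimal[OF submodule_vimage[OF assms(1-4)], of S] S x by auto

lemma linear_map_span_zero:
  assumes V: "module K V" and W: "module K W" and f: "linear_map K V W f"
    and S: "S \<subseteq> carrier V" "\<And>x. x \<in> S \<Longrightarrow> f x = \<zero>\<^bsub>W\<^esub>"
    and x: "x \<in> lin_span K V S"
  shows "f x = \<zero>\<^bsub>W\<^esub>"
  using linear_map_span_into[OF V W f submodule_zero[OF W] S(1) _ x] S(2) by simp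

text \<open>The difference of \<open>f\<close> and \<open>g\<close> is linear and vanishes on
  \<open>S\<close>, hence on the span of \<open>S\<close>.\<close>

lemma linear_map_eq_on_span:
  assumes V: "module K V" and W: "module K W" and f: "linear_map K V W f" and g: "linear_map K V W g"
    and S: "S \<subseteq> carrier V" "lin_span K V S = carrier V" "\<And>x. x \<in> S \<Longrightarrow> f x = g x"
    and x: "x \<in> carrier V"
  shows "f x = g x"
proof -
  interpret W: module K W by (fact W)
  have "f x \<oplus>\<^bsub>W\<^esub> \<ominus>\<^bsub>W\<^esub> g x = \<zero>\<^bsub>W\<^esub>"
    by (rule linear_map_span_zero[OF V W linear_map_sum[OF W f linear_map_uminus[OF W g]] S(1)])
      (use S x linear_map_closed[OF g] in \<open>auto simp: W.r_neg subset_iff\<close>)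
  then show ?thesis
    using linear_map_closed[OF f x] linear_map_closed[OF g x]
      W.minus_equality[of "f x" "\<ominus>\<^bsub>W\<^esub> g x"] by simp
qed

text \<open>Carries a spanning set over to a quotient: from basis vectors to pure tensors, and from
  there to the elements \<open>star K M N aM aN m n\<close>.\<close>

lemma linear_map_span_image:
  assumes V: "module K V" and W: "module K W" and f: "linear_map K V W f" and S: "S \<subseteq> carrier V"
    and span: "lin_span K V S = carrier V" and surj: "f ` carrier V = carrier W"
  shows "lin_span K W (f ` S) = carrier W"
proof
  interpret W: module K W by (fact W)
  have fS: "f ` S \<subseteq> carrier W" using S surj by blast
  show "lin_span K W (f ` S) \<subseteq> carrier W"
    by (rule lin_span_minimal[OF W.carrier_is_submodule fS])
  have "f x \<in> lin_span K W (f ` S)" if "x \<in> carrier V" for x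
    by (rule linear_map_span_into[OF V W f lin_span_submodule[OF W fS] S])
      (use that span lin_span_superset[of "f ` S" K W] in auto)
  then show "carrier W \<subseteq> lin_span K W (f ` S)" unfolding surj[symmetric] by blast
qed

text \<open>One argument is treated at a time: \<open>y\<close> is replaced by a generator while
  \<open>x\<close> stays arbitrary, and then \<open>x\<close> is replaced as well.\<close>

lemma bilinear_map_span_into:
  assumes U: "module K U" and V: "module K V" and W: "module K W" and b: "bilinear_map K U V W b"
    and H: "submodule H K W"
    and S: "S \<subseteq> carrier U" "lin_span K U S = carrier U"
    and S': "S' \<subseteq> carrier V" "lin_span K V S' = carrier V"
    and into: "\<And>x y. \<lbrakk>x \<in> S; y \<in> S'\<rbrakk> \<Longrightarrow> b x y \<in> H"
    and x: "x \<in> carrier U" and y: "y \<in> carrier V"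
  shows "b x y \<in> H"
proof (rule linear_map_span_into[OF V W bilinear_map_right[OF b x] H S'(1)])
  fix y' assume y': "y' \<in> S'"
  show "b x y' \<in> H"
    by (rule linear_map_span_into[OF U W bilinear_map_left[OF b] H S(1)])
      (use y' S' S x into in auto)
qed (use y S' in auto)

section \<open>Quotient spaces\<close>

lemma submodule_abelian_subgroup:
  assumes "module K V" and "submodule W K V"
  shows "abelian_subgroup W V"
  using assms submodule.axioms(1) module.axioms(2)
  by (blast intro: abelian_subgroupI3 additive_subgroup.intro)

lemma quotient_space_carrier:
  "carrier (quotient_space V W) = (\<lambda>x. W +>\<^bsub>V\<^esub> x) ` carrier V"
  by (auto simp: quotient_space_def A_RCOSETS_def')

lemma quotient_space_zero: "\<zero>\<^bsub>quotient_space V W\<^esub> = W"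
  by (simp add: quotient_space_def)

lemma quotient_space_add:
  assumes "module K V" and "submodule W K V" and "x \<in> carrier V" and "y \<in> carrier V"
  shows "(W +>\<^bsub>V\<^esub> x) \<oplus>\<^bsub>quotient_space V W\<^esub> (W +>\<^bsub>V\<^esub> y) = W +>\<^bsub>V\<^esub> (x \<oplus>\<^bsub>V\<^esub> y)"
  using abelian_subgroup.a_rcos_sum[OF submodule_abelian_subgroup[OF assms(1,2)]] assms(3,4)
  by (simp add: quotient_space_def)

text \<open>The union in the definition runs over all representatives of the coset. Each of them
  contributes the same coset, because \<open>W\<close> is closed under scalars; since
  \<open>W\<close> is nonempty, the union is that coset.\<close>

lemma quotient_space_smult:
  assumes V: "module K V" and W: "submodule W K V" and c: "c \<in> carrier K" and x: "x \<in> carrier V"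
  shows "c \<odot>\<^bsub>quotient_space V W\<^esub> (W +>\<^bsub>V\<^esub> x) = W +>\<^bsub>V\<^esub> (c \<odot>\<^bsub>V\<^esub> x)"
proof -
  interpret V: module K V by (fact V)
  interpret W: abelian_subgroup W V by (rule submodule_abelian_subgroup[OF V W])
  have "W +>\<^bsub>V\<^esub> (c \<odot>\<^bsub>V\<^esub> (w \<oplus>\<^bsub>V\<^esub> x)) = W +>\<^bsub>V\<^esub> (c \<odot>\<^bsub>V\<^esub> x)" if w: "w \<in> W" for w
  proof -
    have "w \<in> carrier V" using w W.a_subset by blast
    then have "c \<odot>\<^bsub>V\<^esub> (w \<oplus>\<^bsub>V\<^esub> x) = c \<odot>\<^bsub>V\<^esub> w \<oplus>\<^bsub>V\<^esub> c \<odot>\<^bsub>V\<^esub> x"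
      using c x by (simp add: V.smult_r_distr)
    moreover have "c \<odot>\<^bsub>V\<^esub> w \<in> W" by (rule V.submoduleE(4)[OF W c w])
    ultimately have "c \<odot>\<^bsub>V\<^esub> (w \<oplus>\<^bsub>V\<^esub> x) \<in> W +>\<^bsub>V\<^esub> (c \<odot>\<^bsub>V\<^esub> x)"
      by (auto simp: a_r_coset_def')
    then show ?thesis
      using V.a_repr_independence[OF _ _ W.a_subgroup] c x by simp
  qed
  moreover have "c \<odot>\<^bsub>quotient_space V W\<^esub> (W +>\<^bsub>V\<^esub> x) = (\<Union>w\<in>W. W +>\<^bsub>V\<^esub> (c \<odot>\<^bsub>V\<^esub> (w \<oplus>\<^bsub>V\<^esub> x)))"
    by (auto simp: quotient_space_def a_r_coset_def'[of V W x])
  ultimately have "c \<odot>\<^bsub>quotient_space V W\<^esub> (W +>\<^bsub>V\<^esub> x) = (\<Union>w\<in>W. W +>\<^bsub>V\<^esub> (c \<odot>\<^bsub>V\<^esub> x))"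
    by simp
  moreover have "W \<noteq> {}" using W.zero_closed by blast
  ultimately show ?thesis by simp
qed

lemma quotient_space_coset_zero:
  assumes "module K V" and "submodule W K V" and "x \<in> W"
  shows "W +>\<^bsub>V\<^esub> x = \<zero>\<^bsub>quotient_space V W\<^esub>"
  using assms abelian_group.a_coset_join2[OF module.axioms(2)[OF assms(1)] _ submodule.axioms(1)]
    module.submoduleE(1)[OF assms(1,2)]
  by (metis quotient_space_zero subsetD)

lemma quotient_space_module:
  assumes V: "module K V" and W: "submodule W K V"
  shows "module K (quotient_space V W)"
proof -
  interpret V: module K V by (fact V)
  note add = quotient_space_add[OF V W] and smult = quotient_space_smult[OF V W]
  have zero: "\<zero>\<^bsub>quotient_space V W\<^esub> = W +>\<^bsub>V\<^esub> \<zero>\<^bsub>V\<^esub>"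
    by (rule quotient_space_coset_zero[OF V W submodule_zero_closed[OF W], symmetric])
  have inv: "\<exists>y\<in>carrier V. W +>\<^bsub>V\<^esub> (x \<oplus>\<^bsub>V\<^esub> y) = W +>\<^bsub>V\<^esub> \<zero>\<^bsub>V\<^esub>" if "x \<in> carrier V" for x
    using that by (intro bexI[of _ "\<ominus>\<^bsub>V\<^esub> x"]) (auto simp: V.r_neg)
  show ?thesis
    by (intro moduleI abelian_groupI)
      (auto simp: quotient_space_carrier zero add smult V.a_ac V.smult_l_distr V.smult_r_distr
        V.smult_assoc1 inv V.R.is_cring)
qed

lemma coset_linear_map:
  assumes "module K V" and "submodule W K V"
  shows "linear_map K V (quotient_space V W) (\<lambda>x. W +>\<^bsub>V\<^esub> x)"
  by (rule linear_mapI)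
    (auto simp: quotient_space_carrier quotient_space_add[OF assms] quotient_space_smult[OF assms])

text \<open>As \<open>f\<close> is constant on each coset, the image of a coset under
  \<open>f\<close> is a singleton. Reading off its element with \<open>the_elem\<close> defines the
  lift without a choice of representatives.\<close>

lemma quotient_space_lift:
  assumes V: "module K V" and W: "submodule W K V" and Z: "module K Z"
    and f: "linear_map K V Z f" and kill: "\<And>w. w \<in> W \<Longrightarrow> f w = \<zero>\<^bsub>Z\<^esub>"
  shows "\<exists>g. linear_map K (quotient_space V W) Z g \<and> (\<forall>x\<in>carrier V. g (W +>\<^bsub>V\<^esub> x) = f x)"
proof -
  interpret V: module K V by (fact V)
  interpret Z: module K Z by (fact Z)
  have "f ` (W +>\<^bsub>V\<^esub> x) = {f x}" if x: "x \<in> carrier V" for x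
  proof -
    have "f (w \<oplus>\<^bsub>V\<^esub> x) = f x" if "w \<in> W" for w
      using that x V.submoduleE(1)[OF W] kill linear_map_closed[OF f x]
      by (auto simp: linear_map_add[OF f])
    then show ?thesis
      using submodule_zero_closed[OF W] by (simp add: a_r_coset_def' image_UN)  blast
  qed
  then have eq: "the_elem (f ` (W +>\<^bsub>V\<^esub> x)) = f x" if "x \<in> carrier V" for x
    using that by simp
  have "linear_map K (quotient_space V W) Z (\<lambda>X. the_elem (f ` X))"
    by (rule linear_mapI)
      (auto simp: quotient_space_carrier eq quotient_space_add[OF V W] quotient_space_smult[OF V W]
        linear_mapD[OF f])
  then show ?thesis using eq by blast
qed

section \<open>Free spaces\<close>

lemma free_space_carrier:
  "f \<in> carrier (free_space K X) \<longleftrightarrow> range f \<subseteq> carrier K \<and>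
    finite {x. f x \<noteq> \<zero>\<^bsub>K\<^esub>} \<and> {x. f x \<noteq> \<zero>\<^bsub>K\<^esub>} \<subseteq> X"
  by (simp add: free_space_def)

lemma free_space_apply_closed: "f \<in> carrier (free_space K X) \<Longrightarrow> f x \<in> carrier K"
  by (auto simp: free_space_carrier)

lemma free_space_simps:
  shows "\<zero>\<^bsub>free_space K X\<^esub> = (\<lambda>x. \<zero>\<^bsub>K\<^esub>)"
    and "f \<oplus>\<^bsub>free_space K X\<^esub> g = (\<lambda>x. f x \<oplus>\<^bsub>K\<^esub> g x)"
    and "c \<odot>\<^bsub>free_space K X\<^esub> f = (\<lambda>x. c \<otimes>\<^bsub>K\<^esub> f x)"
  by (simp_all add: free_space_def)

lemma free_space_add_closed:
  assumes K: "cring K" and f: "f \<in> carrier (free_space K X)" and g: "g \<in> carrier (free_space K X)"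
  shows "(\<lambda>x. f x \<oplus>\<^bsub>K\<^esub> g x) \<in> carrier (free_space K X)"
proof -
  interpret K: cring K by (fact K)
  have "{x. f x \<oplus>\<^bsub>K\<^esub> g x \<noteq> \<zero>\<^bsub>K\<^esub>} \<subseteq> {x. f x \<noteq> \<zero>\<^bsub>K\<^esub>} \<union> {x. g x \<noteq> \<zero>\<^bsub>K\<^esub>}"
    by auto
  then show ?thesis
    using f g unfolding free_space_carrier by (blast intro: finite_subset K.add.m_closed)
qed

lemma free_space_smult_closed:
  assumes K: "cring K" and c: "c \<in> carrier K" and f: "f \<in> carrier (free_space K X)"
  shows "(\<lambda>x. c \<otimes>\<^bsub>K\<^esub> f x) \<in> carrier (free_space K X)"
proof -
  interpret K: cring K by (fact K)
  have "{x. c \<otimes>\<^bsub>K\<^esub> f x \<noteq> \<zero>\<^bsub>K\<^esub>} \<subseteq> {x. f x \<noteq> \<zero>\<^bsub>K\<^esub>}"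
    using c by auto
  then show ?thesis
    using f c unfolding free_space_carrier by (blast intro: finite_subset K.m_closed)
qed

lemma free_space_module:
  assumes K: "cring K"
  shows "module K (free_space K X)"
proof -
  interpret K: cring K by (fact K)
  note [simp] = free_space_simps free_space_apply_closed
  \<comment> \<open>The inverse of \<open>f\<close> is its multiple by minus one, so that its
    membership in the carrier follows from closure under scalars.\<close>
  have neg: "\<exists>g\<in>carrier (free_space K X). (\<lambda>x. f x \<oplus>\<^bsub>K\<^esub> g x) = (\<lambda>x. \<zero>\<^bsub>K\<^esub>)"
    if f: "f \<in> carrier (free_space K X)" for f
    using free_space_smult_closed[OF K _ f, of "\<ominus>\<^bsub>K\<^esub> \<one>\<^bsub>K\<^esub>"] f
    by (auto intro!: bexI simp: K.l_minus K.r_neg)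
  show ?thesis
    by (intro moduleI abelian_groupI K)
      (auto simp: free_space_add_closed[OF K] free_space_smult_closed[OF K] K.a_ac K.m_assoc
        K.l_distr K.r_distr neg, auto simp: free_space_carrier[of "\<lambda>x. \<zero>\<^bsub>K\<^esub>"])
qed

lemma basis_vec_closed:
  assumes K: "cring K" and x: "x \<in> X"
  shows "basis_vec K x \<in> carrier (free_space K X)"
proof -
  interpret K: cring K by (fact K)
  have "{y. basis_vec K x y \<noteq> \<zero>\<^bsub>K\<^esub>} \<subseteq> {x}" by (auto simp: basis_vec_def)
  then show ?thesis
    using x finite_subset[of _ "{x}"] by (auto simp: free_space_carrier basis_vec_def)
qed

text \<open>Induction on a finite set containing the support: erasing the value at one point
  \<open>a\<close> changes \<open>f\<close> by \<open>f a\<close> times a basis vector.\<close>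

lemma free_space_span:
  assumes K: "cring K"
  shows "lin_span K (free_space K X) (basis_vec K ` X) = carrier (free_space K X)"
    (is "lin_span K ?F ?B = _")
proof
  interpret K: cring K by (fact K)
  interpret F: module K ?F by (rule free_space_module[OF K])
  have B: "?B \<subseteq> carrier ?F" using basis_vec_closed[OF K] by auto
  show "lin_span K ?F ?B \<subseteq> carrier ?F" by (rule lin_span_minimal[OF F.carrier_is_submodule B])
  have H: "submodule (lin_span K ?F ?B) K ?F" by (rule lin_span_submodule[OF F.module_axioms B])
  \<comment> \<open>The support is only required to be contained in \<open>A\<close>. This leaves
    room for the case where \<open>f\<close> vanishes at the point that the induction adds.\<close>
  have "f \<in> lin_span K ?F ?B" if "finite A" "f \<in> carrier ?F" "{x. f x \<noteq> \<zero>\<^bsub>K\<^esub>} \<subseteq> A" for A f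
    using that
  proof (induction A arbitrary: f rule: finite_induct)
    case empty
    then have "f = \<zero>\<^bsub>?F\<^esub>" by (auto simp: free_space_simps)
    then show ?case using submodule_zero_closed[OF H] by simp
  next
    case (insert a A)
    show ?case
    proof (cases "f a = \<zero>\<^bsub>K\<^esub>")
      case True
      then show ?thesis using insert by (metis (mono_tags, lifting) mem_Collect_eq subset_insert)
    next
      case False
      define g where "g = f(a := \<zero>\<^bsub>K\<^esub>)"
      have a: "a \<in> X" using False insert.prems(1) by (auto simp: free_space_carrier)
      have "{x. g x \<noteq> \<zero>\<^bsub>K\<^esub>} \<subseteq> {x. f x \<noteq> \<zero>\<^bsub>K\<^esub>}" by (auto simp: g_def)
      moreover have "range g \<subseteq> carrier K"
        using free_space_apply_closed[OF insert.prems(1)] by (auto simp: g_def)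
      ultimately have gF: "g \<in> carrier ?F"
        using insert.prems(1) unfolding free_space_carrier by (meson finite_subset order_trans)
      have "{x. g x \<noteq> \<zero>\<^bsub>K\<^esub>} \<subseteq> A" using insert.prems(2) by (auto simp: g_def)
      then have g: "g \<in> lin_span K ?F ?B" by (rule insert.IH[OF gF])
      have fa: "f a \<in> carrier K" using free_space_apply_closed[OF insert.prems(1)] .
      have "f = g \<oplus>\<^bsub>?F\<^esub> f a \<odot>\<^bsub>?F\<^esub> basis_vec K a"
        using free_space_apply_closed[OF insert.prems(1)]
        by (auto simp: free_space_simps g_def basis_vec_def)
      moreover have "basis_vec K a \<in> lin_span K ?F ?B" using a lin_span_superset by fast
      ultimately show ?thesis using g fa F.submoduleE(4,5)[OF H] by metis
    qed
  qed
  then show "carrier ?F \<subseteq> lin_span K ?F ?B" by (auto simp: free_space_carrier)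
qed

text \<open>The linear extension of \<open>\<phi>\<close> is given by a finite sum over the support
  of the argument.\<close>

lemma free_space_lift:
  fixes \<phi> :: "'x \<Rightarrow> 'v"
  assumes K: "cring K" and Z: "module K Z" and \<phi>: "\<And>x. x \<in> X \<Longrightarrow> \<phi> x \<in> carrier Z"
  shows "\<exists>f. linear_map K (free_space K X) Z f \<and> (\<forall>x\<in>X. f (basis_vec K x) = \<phi> x)"
proof -
  interpret Z: module K Z by (fact Z)
  define S where "S f = {x. f x \<noteq> \<zero>\<^bsub>K\<^esub>}" for f :: "'x \<Rightarrow> 'a"
  define L where "L f = (\<Oplus>\<^bsub>Z\<^esub>x\<in>S f. f x \<odot>\<^bsub>Z\<^esub> \<phi> x)" for f :: "'x \<Rightarrow> 'a"
  \<comment> \<open>The index set may be enlarged from the support to any finite subset of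
    \<open>X\<close>. This is what makes additivity provable: the supports of \<open>f\<close>,
    \<open>g\<close> and their sum differ, but all lie in the union of the first two.\<close>
  have L: "L f = (\<Oplus>\<^bsub>Z\<^esub>x\<in>A. f x \<odot>\<^bsub>Z\<^esub> \<phi> x)"
    if "f \<in> carrier (free_space K X)" "finite A" "S f \<subseteq> A" "A \<subseteq> X" for f A
    unfolding L_def using that \<phi>
    by (intro Z.add.finprod_mono_neutral_cong_left)
      (auto simp: S_def free_space_apply_closed subset_iff)
  have S: "finite (S f)" "S f \<subseteq> X" if "f \<in> carrier (free_space K X)" for f
    using that by (auto simp: free_space_carrier S_def)
  have cl: "(\<lambda>x. f x \<odot>\<^bsub>Z\<^esub> \<phi> x) \<in> A \<rightarrow> carrier Z"
    if "f \<in> carrier (free_space K X)" "A \<subseteq> X" for f A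
    using that \<phi> by (auto simp: free_space_apply_closed subset_iff)
  have "linear_map K (free_space K X) Z L"
  proof (rule linear_mapI)
    fix f assume f: "f \<in> carrier (free_space K X)"
    show "L f \<in> carrier Z"
      unfolding L_def by (rule Z.finsum_closed[OF cl[OF f S(2)[OF f]]])
    fix g assume g: "g \<in> carrier (free_space K X)"
    let ?A = "S f \<union> S g"
    have A: "finite ?A" "?A \<subseteq> X" using S[OF f] S[OF g] by auto
    have "L (\<lambda>x. f x \<oplus>\<^bsub>K\<^esub> g x) = (\<Oplus>\<^bsub>Z\<^esub>x\<in>?A. (f x \<oplus>\<^bsub>K\<^esub> g x) \<odot>\<^bsub>Z\<^esub> \<phi> x)"
      by (rule L) (use free_space_add_closed[OF K f g] A in \<open>auto simp: S_def\<close>)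
    also have "\<dots> = (\<Oplus>\<^bsub>Z\<^esub>x\<in>?A. f x \<odot>\<^bsub>Z\<^esub> \<phi> x \<oplus>\<^bsub>Z\<^esub> g x \<odot>\<^bsub>Z\<^esub> \<phi> x)"
      using A \<phi> f g
      by (intro Z.finsum_cong') (auto simp: free_space_apply_closed Z.smult_l_distr subset_iff)
    also have "\<dots> = L f \<oplus>\<^bsub>Z\<^esub> L g"
      using Z.finsum_addf[OF cl[OF f A(2)] cl[OF g A(2)]] L[OF f A(1) _ A(2)] L[OF g A(1) _ A(2)]
      by simp
    finally show "L (f \<oplus>\<^bsub>free_space K X\<^esub> g) = L f \<oplus>\<^bsub>Z\<^esub> L g"
      by (simp add: free_space_simps)
  next
    fix c f assume c: "c \<in> carrier K" and f: "f \<in> carrier (free_space K X)"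
    have "L (\<lambda>x. c \<otimes>\<^bsub>K\<^esub> f x) = (\<Oplus>\<^bsub>Z\<^esub>x\<in>S f. (c \<otimes>\<^bsub>K\<^esub> f x) \<odot>\<^bsub>Z\<^esub> \<phi> x)"
      by (rule L) (use free_space_smult_closed[OF K c f] S[OF f] c in \<open>auto simp: S_def\<close>)
    also have "\<dots> = (\<Oplus>\<^bsub>Z\<^esub>x\<in>S f. c \<odot>\<^bsub>Z\<^esub> (f x \<odot>\<^bsub>Z\<^esub> \<phi> x))"
      using S[OF f] \<phi> f c
      by (intro Z.finsum_cong') (auto simp: free_space_apply_closed Z.smult_assoc1 subset_iff)
    also have "\<dots> = c \<odot>\<^bsub>Z\<^esub> L f"
      unfolding L_def by (rule Z.finsum_smult_ldistr[symmetric, OF S(1)[OF f] c cl[OF f S(2)[OF f]]])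
    finally show "L (c \<odot>\<^bsub>free_space K X\<^esub> f) = c \<odot>\<^bsub>Z\<^esub> L f"
      by (simp add: free_space_simps)
  qed
  moreover have "L (basis_vec K x) = \<phi> x" if x: "x \<in> X" for x
  proof -
    have "L (basis_vec K x) = (\<Oplus>\<^bsub>Z\<^esub>y\<in>{x}. basis_vec K x y \<odot>\<^bsub>Z\<^esub> \<phi> y)"
      by (rule L) (use basis_vec_closed[OF K x] x in \<open>auto simp: S_def basis_vec_def\<close>)
    then show ?thesis using \<phi>[OF x] by (simp add: basis_vec_def)
  qed
  ultimately show ?thesis by blast
qed

text \<open>Turns a relation that has the form of a difference into an equality of classes in the
  quotient.\<close>

lemma coset_eqI:
  assumes V: "module K V" and W: "submodule W K V" and x: "x \<in> carrier V" and y: "y \<in> carrier V"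
    and diff: "x \<ominus>\<^bsub>V\<^esub> y \<in> W"
  shows "W +>\<^bsub>V\<^esub> x = W +>\<^bsub>V\<^esub> y"
proof -
  interpret V: module K V by (fact V)
  have W': "subgroup W (add_monoid V)" using W by (rule submodule.axioms(1))
  have "x = (x \<ominus>\<^bsub>V\<^esub> y) \<oplus>\<^bsub>V\<^esub> y"
    using x y by (simp add: a_minus_def V.a_assoc V.l_neg)
  then have "x \<in> W +>\<^bsub>V\<^esub> y"
    using diff by (auto simp: a_r_coset_def')
  then show ?thesis
    using V.a_repr_independence[OF _ y W'] by simp
qed

section \<open>Tensor products of vector spaces\<close>

lemma tensor_relations_closed:
  assumes U: "module K U" and V: "module K V"
  shows "tensor_relations K U V \<subseteq> carrier (free_space K (carrier U \<times> carrier V))"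
proof -
  interpret U: module K U by (fact U)
  interpret V: module K V by (fact V)
  interpret F: module K "free_space K (carrier U \<times> carrier V)"
    by (rule free_space_module[OF U.R.is_cring])
  show ?thesis
    by (auto simp: tensor_relations_def Let_def basis_vec_closed[OF U.R.is_cring])
qed

lemma tensor_relations_submodule:
  assumes U: "module K U" and V: "module K V"
  shows "submodule (lin_span K (free_space K (carrier U \<times> carrier V)) (tensor_relations K U V)) K
    (free_space K (carrier U \<times> carrier V))"
  using module.axioms(1)[OF U] tensor_relations_closed[OF U V]
  by (intro lin_span_submodule free_space_module)

lemma tensor_space_module:
  assumes U: "module K U" and V: "module K V"
  shows "module K (tensor_space K U V)"
  unfolding tensor_space_def Let_def using module.axioms(1)[OF U]
  by (intro quotient_space_module free_space_module tensor_relations_submodule[OF U V])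

lemma pure_tensor_closed:
  assumes "module K U" and "x \<in> carrier U" and "y \<in> carrier V"
  shows "pure_tensor K U V x y \<in> carrier (tensor_space K U V)"
  using assms basis_vec_closed[OF module.axioms(1)[OF assms(1)], of "(x, y)" "carrier U \<times> carrier V"]
  by (auto simp: pure_tensor_def tensor_space_def Let_def quotient_space_carrier)

text \<open>The four families in \<open>tensor_relations\<close> correspond one by one to additivity
  and homogeneity in each of the two arguments.\<close>

lemma pure_tensor_bilinear:
  assumes U: "module K U" and V: "module K V"
  shows "bilinear_map K U V (tensor_space K U V) (pure_tensor K U V)"
proof -
  let ?F = "free_space K (carrier U \<times> carrier V)"
  let ?W = "lin_span K ?F (tensor_relations K U V)"
  interpret U: module K U by (fact U)
  interpret V: module K V by (fact V)
  have F: "module K ?F" by (rule free_space_module[OF U.R.is_cring])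
  interpret F: module K ?F by (fact F)
  note W = tensor_relations_submodule[OF U V]
  note [simp] = basis_vec_closed[OF U.R.is_cring]
  have eqI: "?W +>\<^bsub>?F\<^esub> f = ?W +>\<^bsub>?F\<^esub> g"
    if "f \<ominus>\<^bsub>?F\<^esub> g \<in> tensor_relations K U V" "f \<in> carrier ?F" "g \<in> carrier ?F" for f g
    using coset_eqI[OF F W that(2,3)] subsetD[OF lin_span_superset that(1)] by blast
  note defs = pure_tensor_def tensor_space_def Let_def
  show ?thesis
    unfolding bilinear_map_def
  proof (intro conjI ballI linear_mapI)
    fix x y assume x: "x \<in> carrier U" and y: "y \<in> carrier V"
    \<comment> \<open>This goal occurs twice, once for linearity in each argument.\<close>
    show "pure_tensor K U V x y \<in> carrier (tensor_space K U V)"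
      and "pure_tensor K U V x y \<in> carrier (tensor_space K U V)"
      using pure_tensor_closed[OF U x y] by simp_all
    fix x' assume x': "x' \<in> carrier U"
    have "basis_vec K (x \<oplus>\<^bsub>U\<^esub> x', y) \<ominus>\<^bsub>?F\<^esub> (basis_vec K (x, y) \<oplus>\<^bsub>?F\<^esub> basis_vec K (x', y))
        \<in> tensor_relations K U V"
      using x x' y unfolding tensor_relations_def Let_def by blast
    from eqI[OF this] show "pure_tensor K U V (x \<oplus>\<^bsub>U\<^esub> x') y =
        pure_tensor K U V x y \<oplus>\<^bsub>tensor_space K U V\<^esub> pure_tensor K U V x' y"
      using x x' y by (simp add: defs quotient_space_add[OF F W])
  next
    fix x y y' assume x: "x \<in> carrier U" and y: "y \<in> carrier V" and y': "y' \<in> carrier V"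
    have "basis_vec K (x, y \<oplus>\<^bsub>V\<^esub> y') \<ominus>\<^bsub>?F\<^esub> (basis_vec K (x, y) \<oplus>\<^bsub>?F\<^esub> basis_vec K (x, y'))
        \<in> tensor_relations K U V"
      using x y y' unfolding tensor_relations_def Let_def by blast
    from eqI[OF this] show "pure_tensor K U V x (y \<oplus>\<^bsub>V\<^esub> y') =
        pure_tensor K U V x y \<oplus>\<^bsub>tensor_space K U V\<^esub> pure_tensor K U V x y'"
      using x y y' by (simp add: defs quotient_space_add[OF F W])
  next
    fix x c y assume x: "x \<in> carrier U" and c: "c \<in> carrier K" and y: "y \<in> carrier V"
    have "basis_vec K (x, c \<odot>\<^bsub>V\<^esub> y) \<ominus>\<^bsub>?F\<^esub> c \<odot>\<^bsub>?F\<^esub> basis_vec K (x, y) \<in> tensor_relations K U V"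
      using x c y unfolding tensor_relations_def Let_def by blast
    from eqI[OF this]
    show "pure_tensor K U V x (c \<odot>\<^bsub>V\<^esub> y) = c \<odot>\<^bsub>tensor_space K U V\<^esub> pure_tensor K U V x y"
      using x c y by (simp add: defs quotient_space_smult[OF F W])
  next
    fix y c x assume x: "x \<in> carrier U" and c: "c \<in> carrier K" and y: "y \<in> carrier V"
    have "basis_vec K (c \<odot>\<^bsub>U\<^esub> x, y) \<ominus>\<^bsub>?F\<^esub> c \<odot>\<^bsub>?F\<^esub> basis_vec K (x, y) \<in> tensor_relations K U V"
      using x c y unfolding tensor_relations_def Let_def by blast
    from eqI[OF this]
    show "pure_tensor K U V (c \<odot>\<^bsub>U\<^esub> x) y = c \<odot>\<^bsub>tensor_space K U V\<^esub> pure_tensor K U V x y"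
      using x c y by (simp add: defs quotient_space_smult[OF F W])
  qed
qed

text \<open>Pure tensors are the images of the basis vectors under the surjection from the free
  space.\<close>

lemma tensor_space_span:
  assumes U: "module K U" and V: "module K V"
  shows "lin_span K (tensor_space K U V)
      {pure_tensor K U V x y | x y. x \<in> carrier U \<and> y \<in> carrier V} = carrier (tensor_space K U V)"
proof -
  let ?X = "carrier U \<times> carrier V"
  let ?F = "free_space K ?X"
  let ?W = "lin_span K ?F (tensor_relations K U V)"
  have K: "cring K" by (rule module.axioms(1)[OF U])
  have F: "module K ?F" by (rule free_space_module[OF K])
  note W = tensor_relations_submodule[OF U V]
  have B: "basis_vec K ` ?X \<subseteq> carrier ?F"
    using basis_vec_closed[OF K] by (rule image_subsetI)
  have "lin_span K (quotient_space ?F ?W) ((\<lambda>f. ?W +>\<^bsub>?F\<^esub> f) ` basis_vec K ` ?X)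
      = carrier (quotient_space ?F ?W)"
    by (rule linear_map_span_image[OF F quotient_space_module[OF F W] coset_linear_map[OF F W] B
          free_space_span[OF K] quotient_space_carrier[symmetric]])
  moreover have "(\<lambda>f. ?W +>\<^bsub>?F\<^esub> f) ` basis_vec K ` ?X =
      {pure_tensor K U V x y | x y. x \<in> carrier U \<and> y \<in> carrier V}"
    unfolding pure_tensor_def Let_def by blast
  ultimately show ?thesis by (simp add: tensor_space_def Let_def)
qed

text \<open>The universal property of the tensor product: extend \<open>b\<close> from the basis to
  the free space; by bilinearity the extension kills the relations, so it descends to the
  quotient.\<close>

lemma tensor_space_lift:
  assumes U: "module K U" and V: "module K V" and Z: "module K Z" and b: "bilinear_map K U V Z b"
  shows "\<exists>f. linear_map K (tensor_space K U V) Z f \<and>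
    (\<forall>x\<in>carrier U. \<forall>y\<in>carrier V. f (pure_tensor K U V x y) = b x y)"
proof -
  let ?X = "carrier U \<times> carrier V"
  let ?F = "free_space K ?X"
  let ?W = "lin_span K ?F (tensor_relations K U V)"
  interpret U: module K U by (fact U)
  interpret V: module K V by (fact V)
  interpret Z: module K Z by (fact Z)
  have F: "module K ?F" by (rule free_space_module[OF U.R.is_cring])
  interpret F: module K ?F by (fact F)
  note W = tensor_relations_submodule[OF U V]
  note [simp] = basis_vec_closed[OF U.R.is_cring]
  note cl = bilinear_map_closed[OF b]
  obtain g where g: "linear_map K ?F Z g" and
    gb: "\<And>x y. \<lbrakk>x \<in> carrier U; y \<in> carrier V\<rbrakk> \<Longrightarrow> g (basis_vec K (x, y)) = b x y"
    using free_space_lift[OF U.R.is_cring Z, of ?X "\<lambda>(x, y). b x y"] cl by auto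
  have Z_diff_self: "z \<ominus>\<^bsub>Z\<^esub> z = \<zero>\<^bsub>Z\<^esub>" if "z \<in> carrier Z" for z
    using that by (simp add: a_minus_def Z.r_neg)
  have "g r = \<zero>\<^bsub>Z\<^esub>" if "r \<in> tensor_relations K U V" for r
    using that unfolding tensor_relations_def Let_def
    by (auto simp: linear_map_diff[OF F Z g] linear_map_add[OF g] linear_map_smult[OF g] gb cl
        linear_map_add[OF bilinear_map_left[OF b]] linear_map_add[OF bilinear_map_right[OF b]]
        linear_map_smult[OF bilinear_map_left[OF b]] linear_map_smult[OF bilinear_map_right[OF b]]
        Z_diff_self)
  then have "g w = \<zero>\<^bsub>Z\<^esub>" if "w \<in> ?W" for w
    using linear_map_span_zero[OF F Z g tensor_relations_closed[OF U V]] that by blast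
  from quotient_space_lift[OF F W Z g this] obtain f
    where f: "linear_map K (quotient_space ?F ?W) Z f"
      and fg: "\<And>h. h \<in> carrier ?F \<Longrightarrow> f (?W +>\<^bsub>?F\<^esub> h) = g h"
    by blast
  show ?thesis
    by (rule exI[of _ f]) (use f in \<open>simp add: tensor_space_def pure_tensor_def Let_def fg gb\<close>)
qed

section \<open>Hom-Lie algebras with compatible actions\<close>

context hom_lie_algebra
begin

lemma module_L: "module K L" by (rule module_axioms)

lemma bracket_closed [simp]: "\<lbrakk>x \<in> carrier L; y \<in> carrier L\<rbrakk> \<Longrightarrow> \<lbrakk>x, y\<rbrakk>\<^bsub>L\<^esub> \<in> carrier L"
  using bracket_bilinear by (rule bilinear_map_closed)

lemma twist_closed [simp]: "x \<in> carrier L \<Longrightarrow> twist L x \<in> carrier L"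
  using twist_linear by (rule linear_map_closed)

text \<open>Negate the Hom-Jacobi identity and flip the three outer brackets by skew-symmetry.
  Compatibility of the actions produces nested brackets in this order.\<close>

lemma hom_jacobi':
  assumes "x \<in> carrier L" "y \<in> carrier L" "z \<in> carrier L"
  shows "\<lbrakk>\<lbrakk>x, y\<rbrakk>\<^bsub>L\<^esub>, twist L z\<rbrakk>\<^bsub>L\<^esub> \<oplus>\<^bsub>L\<^esub> \<lbrakk>\<lbrakk>y, z\<rbrakk>\<^bsub>L\<^esub>, twist L x\<rbrakk>\<^bsub>L\<^esub> \<oplus>\<^bsub>L\<^esub> \<lbrakk>\<lbrakk>z, x\<rbrakk>\<^bsub>L\<^esub>, twist L y\<rbrakk>\<^bsub>L\<^esub> = \<zero>\<^bsub>L\<^esub>"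
proof -
  have "\<ominus>\<^bsub>L\<^esub> (\<lbrakk>twist L x, \<lbrakk>y, z\<rbrakk>\<^bsub>L\<^esub>\<rbrakk>\<^bsub>L\<^esub> \<oplus>\<^bsub>L\<^esub> \<lbrakk>twist L z, \<lbrakk>x, y\<rbrakk>\<^bsub>L\<^esub>\<rbrakk>\<^bsub>L\<^esub> \<oplus>\<^bsub>L\<^esub> \<lbrakk>twist L y, \<lbrakk>z, x\<rbrakk>\<^bsub>L\<^esub>\<rbrakk>\<^bsub>L\<^esub>) = \<zero>\<^bsub>L\<^esub>"
    using assms by (simp add: hom_jacobi)
  then show ?thesis
    using assms skew[of "\<lbrakk>x, y\<rbrakk>\<^bsub>L\<^esub>" "twist L z"] skew[of "\<lbrakk>y, z\<rbrakk>\<^bsub>L\<^esub>" "twist L x"]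
      skew[of "\<lbrakk>z, x\<rbrakk>\<^bsub>L\<^esub>" "twist L y"]
    by (simp add: M.minus_add M.a_ac)
qed

text \<open>Skew-symmetry says that twice the bracket is zero, and two is a unit of the
  field.\<close>

lemma bracket_self_zero:
  assumes "\<one>\<^bsub>K\<^esub> \<oplus>\<^bsub>K\<^esub> \<one>\<^bsub>K\<^esub> \<noteq> \<zero>\<^bsub>K\<^esub>" and x: "x \<in> carrier L"
  shows "\<lbrakk>x, x\<rbrakk>\<^bsub>L\<^esub> = \<zero>\<^bsub>L\<^esub>"
proof -
  let ?y = "\<lbrakk>x, x\<rbrakk>\<^bsub>L\<^esub>" and ?two = "\<one>\<^bsub>K\<^esub> \<oplus>\<^bsub>K\<^esub> \<one>\<^bsub>K\<^esub>"
  have y: "?y \<in> carrier L" using x by simp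
  have "?y \<oplus>\<^bsub>L\<^esub> ?y = \<zero>\<^bsub>L\<^esub>"
    using skew[OF x x] M.r_neg[OF y] by simp
  then have "?two \<odot>\<^bsub>L\<^esub> ?y = \<zero>\<^bsub>L\<^esub>"
    using y by (simp add: smult_l_distr)
  moreover have two: "?two \<in> Units K" using assms(1) by (simp add: field_Units)
  ultimately have "(inv\<^bsub>K\<^esub> ?two \<otimes>\<^bsub>K\<^esub> ?two) \<odot>\<^bsub>L\<^esub> ?y = \<zero>\<^bsub>L\<^esub>"
    using y by (simp only: smult_assoc1 Units_inv_closed Units_closed smult_r_null)
  then show ?thesis
    using y Units_l_inv[OF two] by simp
qed

end

section \<open>Hom-actions and their compatibility\<close>

lemma hom_actionD:
  assumes "hom_action K L M act"
  shows hom_action_bilinear: "bilinear_map K L M M act"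
    and hom_action_bracket: "\<lbrakk>x \<in> carrier L; y \<in> carrier L; m \<in> carrier M\<rbrakk> \<Longrightarrow>
      act \<lbrakk>x, y\<rbrakk>\<^bsub>L\<^esub> (twist M m) = act (twist L x) (act y m) \<ominus>\<^bsub>M\<^esub> act (twist L y) (act x m)"
    and hom_action_derivation: "\<lbrakk>x \<in> carrier L; m \<in> carrier M; m' \<in> carrier M\<rbrakk> \<Longrightarrow>
      act (twist L x) \<lbrakk>m, m'\<rbrakk>\<^bsub>M\<^esub> = \<lbrakk>act x m, twist M m'\<rbrakk>\<^bsub>M\<^esub> \<oplus>\<^bsub>M\<^esub> \<lbrakk>twist M m, act x m'\<rbrakk>\<^bsub>M\<^esub>"
    and hom_action_twist: "\<lbrakk>x \<in> carrier L; m \<in> carrier M\<rbrakk> \<Longrightarrow>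
      twist M (act x m) = act (twist L x) (twist M m)"
  using assms unfolding hom_action_def by blast+

text \<open>The alternating laws are assumed directly, which covers both alternatives in the
  theorem: outside characteristic 2 they follow from skew-symmetry.\<close>

locale compatible_hom_lie_algebras =
  M: hom_lie_algebra K M + N: hom_lie_algebra K N
  for K :: "('k, 'z) ring_scheme"
    and M :: "('k, 'm, 'p) hom_lie_scheme"
    and N :: "('k, 'n, 'q) hom_lie_scheme"
    and aM :: "'m \<Rightarrow> 'n \<Rightarrow> 'n"
    and aN :: "'n \<Rightarrow> 'm \<Rightarrow> 'm" +
  assumes action_M: "hom_action K M N aM" and action_N: "hom_action K N M aN"
    and compatible: "compatible_actions M N aM aN"
    and alternating_M: "x \<in> carrier M \<Longrightarrow> \<lbrakk>x, x\<rbrakk>\<^bsub>M\<^esub> = \<zero>\<^bsub>M\<^esub>"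
    and alternating_N: "y \<in> carrier N \<Longrightarrow> \<lbrakk>y, y\<rbrakk>\<^bsub>N\<^esub> = \<zero>\<^bsub>N\<^esub>"
begin

text \<open>The assumptions are symmetric in \<open>M\<close> and \<open>N\<close>, so each lemma of
  the locale also holds with the two exchanged.\<close>

lemma swap: "compatible_hom_lie_algebras K N M aN aM"
  using M.hom_lie_algebra_axioms N.hom_lie_algebra_axioms action_M action_N compatible
    alternating_M alternating_N
  by (auto simp: compatible_hom_lie_algebras_def compatible_hom_lie_algebras_axioms_def
      compatible_actions_def)

lemma action_closed [simp]:
  assumes "m \<in> carrier M" "n \<in> carrier N"
  shows "aM m n \<in> carrier N" and "aN n m \<in> carrier M"
  using assms bilinear_map_closed[OF hom_action_bilinear[OF action_M]]
    bilinear_map_closed[OF hom_action_bilinear[OF action_N]] by simp_all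

lemma compatible_N:
  "\<lbrakk>m \<in> carrier M; m' \<in> carrier M; n \<in> carrier N\<rbrakk> \<Longrightarrow> aN (aM m n) m' = \<lbrakk>m', aN n m\<rbrakk>\<^bsub>M\<^esub>"
  and compatible_M:
  "\<lbrakk>m \<in> carrier M; n \<in> carrier N; n' \<in> carrier N\<rbrakk> \<Longrightarrow> aM (aN n m) n' = \<lbrakk>n', aM m n\<rbrakk>\<^bsub>N\<^esub>"
  using compatible unfolding compatible_actions_def by blast+

text \<open>
  The lemmas \<open>kill_relation\<close> say that \<open>m \<otimes> n \<mapsto> \<^sup>nm\<close> vanishes on the five families of relations. The
  map \<open>m \<otimes> n \<mapsto> \<^sup>mn\<close> is obtained by exchanging \<open>M\<close> and \<open>N\<close>, except for the fifth family, which is not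
  symmetric.
\<close>

lemma kill_relation_1:
  assumes m: "m \<in> carrier M" and m': "m' \<in> carrier M" and n: "n \<in> carrier N"
  shows "aN (twist N n) \<lbrakk>m, m'\<rbrakk>\<^bsub>M\<^esub> \<ominus>\<^bsub>M\<^esub> aN (aM m' n) (twist M m) \<oplus>\<^bsub>M\<^esub> aN (aM m n) (twist M m') = \<zero>\<^bsub>M\<^esub>"
proof -
  \<comment> \<open>By the derivation law and compatibility, the three terms are built from these
    two brackets alone: the first is \<open>?x\<close> plus \<open>?y\<close>, the second is
    \<open>?y\<close>, the third is minus \<open>?x\<close>.\<close>
  let ?x = "\<lbrakk>aN n m, twist M m'\<rbrakk>\<^bsub>M\<^esub>" and ?y = "\<lbrakk>twist M m, aN n m'\<rbrakk>\<^bsub>M\<^esub>"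
  have "aN (twist N n) \<lbrakk>m, m'\<rbrakk>\<^bsub>M\<^esub> = ?x \<oplus>\<^bsub>M\<^esub> ?y"
    using assms by (simp add: hom_action_derivation[OF action_N])
  moreover have "aN (aM m' n) (twist M m) = ?y"
    using assms by (simp add: compatible_N)
  moreover have "aN (aM m n) (twist M m') = \<ominus>\<^bsub>M\<^esub> ?x"
    using assms M.skew[of "twist M m'" "aN n m"] by (simp add: compatible_N)
  moreover have "?x \<in> carrier M" "?y \<in> carrier M" using assms by simp_all
  ultimately show ?thesis
    by (simp add: a_minus_def M.a_assoc M.r_neg)
qed

lemma kill_relation_2:
  assumes "m \<in> carrier M" and "n \<in> carrier N" and "n' \<in> carrier N"
  shows "aN \<lbrakk>n, n'\<rbrakk>\<^bsub>N\<^esub> (twist M m) \<ominus>\<^bsub>M\<^esub> aN (twist N n) (aN n' m) \<oplus>\<^bsub>M\<^esub> aN (twist N n') (aN n m) = \<zero>\<^bsub>M\<^esub>"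
  using assms
  by (simp add: hom_action_bracket[OF action_N] a_minus_def M.a_ac M.r_neg M.r_neg1 M.r_neg2)

lemma kill_relation_3:
  assumes "m \<in> carrier M" and "n \<in> carrier N"
  shows "aN (aM m n) (aN n m) = \<zero>\<^bsub>M\<^esub>"
  using assms by (simp add: compatible_N alternating_M)

lemma kill_relation_4:
  assumes "m \<in> carrier M" "m' \<in> carrier M" and "n \<in> carrier N" "n' \<in> carrier N"
  shows "aN (aM m' n') (aN n m) \<oplus>\<^bsub>M\<^esub> aN (aM m n) (aN n' m') = \<zero>\<^bsub>M\<^esub>"
  using assms M.skew[of "aN n m" "aN n' m'"] by (simp add: compatible_N M.l_neg)

text \<open>Both are instances of compatibility. The order of the factors is kept in
  \<open>M\<close> but reversed in \<open>N\<close>.\<close>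

lemma bracket_actions:
  assumes "m \<in> carrier M" "m' \<in> carrier M" and "n \<in> carrier N" "n' \<in> carrier N"
  shows "aN (aM m' n') (aN n m) = \<lbrakk>aN n m, aN n' m'\<rbrakk>\<^bsub>M\<^esub>"
    and "aM (aN n m) (aM m' n') = \<lbrakk>aM m' n', aM m n\<rbrakk>\<^bsub>N\<^esub>"
  using assms by (simp_all add: compatible_M compatible_N)

lemma kill_relation_5_M:
  assumes "m \<in> carrier M" "m' \<in> carrier M" "m'' \<in> carrier M"
    and "n \<in> carrier N" "n' \<in> carrier N" "n'' \<in> carrier N"
  shows "aN (twist N (aM m'' n'')) \<lbrakk>aN n m, aN n' m'\<rbrakk>\<^bsub>M\<^esub>
    \<oplus>\<^bsub>M\<^esub> aN (twist N (aM m n)) \<lbrakk>aN n' m', aN n'' m''\<rbrakk>\<^bsub>M\<^esub>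
    \<oplus>\<^bsub>M\<^esub> aN (twist N (aM m' n')) \<lbrakk>aN n'' m'', aN n m\<rbrakk>\<^bsub>M\<^esub> = \<zero>\<^bsub>M\<^esub>"
  using assms M.hom_jacobi'[of "aN n m" "aN n' m'" "aN n'' m''"]
  by (simp add: hom_action_twist[OF action_M] hom_action_twist[OF action_N] compatible_N)

lemma kill_relation_5_N:
  assumes "m \<in> carrier M" "m' \<in> carrier M" "m'' \<in> carrier M"
    and "n \<in> carrier N" "n' \<in> carrier N" "n'' \<in> carrier N"
  shows "aM \<lbrakk>aN n m, aN n' m'\<rbrakk>\<^bsub>M\<^esub> (twist N (aM m'' n''))
    \<oplus>\<^bsub>N\<^esub> aM \<lbrakk>aN n' m', aN n'' m''\<rbrakk>\<^bsub>M\<^esub> (twist N (aM m n))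
    \<oplus>\<^bsub>N\<^esub> aM \<lbrakk>aN n'' m'', aN n m\<rbrakk>\<^bsub>M\<^esub> (twist N (aM m' n')) = \<zero>\<^bsub>N\<^esub>"
proof -
  \<comment> \<open>Compatibility describes how an element of the form \<open>aN y x\<close> acts on
    \<open>N\<close>. The bracket in \<open>M\<close> is brought into this form by reading it as the
    action of \<open>aM m' n'\<close> on \<open>aN n m\<close>.\<close>
  have "aM \<lbrakk>aN n m, aN n' m'\<rbrakk>\<^bsub>M\<^esub> y = \<lbrakk>y, \<lbrakk>aM m' n', aM m n\<rbrakk>\<^bsub>N\<^esub>\<rbrakk>\<^bsub>N\<^esub>"
    if "m \<in> carrier M" "m' \<in> carrier M" "n \<in> carrier N" "n' \<in> carrier N" "y \<in> carrier N"
    for m m' n n' y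
  proof -
    have "aM \<lbrakk>aN n m, aN n' m'\<rbrakk>\<^bsub>M\<^esub> y = aM (aN (aM m' n') (aN n m)) y"
      using that by (simp only: bracket_actions)
    also have "\<dots> = \<lbrakk>y, aM (aN n m) (aM m' n')\<rbrakk>\<^bsub>N\<^esub>"
      using that by (intro compatible_M) simp_all
    finally show ?thesis using that by (simp only: bracket_actions)
  qed
  \<comment> \<open>The inner brackets in \<open>N\<close> come out reversed, so the Hom-Jacobi
    identity is used with the three elements in reversed order.\<close>
  then show ?thesis
    using assms N.hom_jacobi[of "aM m'' n''" "aM m' n'" "aM m n"] by simp
qed

end

section \<open>The non-abelian tensor product as a Hom-Lie algebra\<close>

text \<open>Being a module depends on these four fields only. This transports the structure from
  \<open>star_space\<close> to the larger record \<open>star_product\<close>.\<close>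

lemma module_fields_cong:
  assumes V: "module K V"
    and eq: "carrier V' = carrier V" "zero V' = zero V" "add V' = add V" "smult V' = smult V"
  shows "module K V'"
proof -
  interpret V: module K V by (fact V)
  have inv: "\<exists>y\<in>carrier V. x \<oplus>\<^bsub>V\<^esub> y = \<zero>\<^bsub>V\<^esub>" if "x \<in> carrier V" for x
    using that by (intro bexI[of _ "\<ominus>\<^bsub>V\<^esub> x"]) (simp_all add: V.r_neg)
  show ?thesis
    by (intro moduleI abelian_groupI)
      (simp_all add: eq V.R.is_cring V.smult_l_distr V.smult_r_distr V.smult_assoc1 V.a_ac inv)
qed

lemma lin_span_fields_cong:
  assumes "carrier V' = carrier V" "zero V' = zero V" "add V' = add V" "smult V' = smult V"
  shows "lin_span K V' S = lin_span K V S"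
proof -
  have "submodule H K V' \<longleftrightarrow> submodule H K V" for H
    by (simp add: submodule_def submodule_axioms_def subgroup_def m_inv_def assms)
  then show ?thesis by (simp add: lin_span_def)
qed

section \<open>The space underlying the tensor product: generators, relations, universal
  property\<close>

context compatible_hom_lie_algebras
begin

abbreviation "T \<equiv> tensor_space K M N"
abbreviation "t \<equiv> pure_tensor K M N"
abbreviation "W \<equiv> lin_span K T (star_relations K M N aM aN)"
abbreviation "Q \<equiv> star_space K M N aM aN"
abbreviation "s \<equiv> star K M N aM aN"

lemma T_module: "module K T"
  by (rule tensor_space_module[OF M.module_L N.module_L])

lemma t_closed [simp]: "\<lbrakk>m \<in> carrier M; n \<in> carrier N\<rbrakk> \<Longrightarrow> t m n \<in> carrier T"
  by (rule pure_tensor_closed[OF M.module_L])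

lemma star_relations_closed: "star_relations K M N aM aN \<subseteq> carrier T"
proof -
  interpret T: module K T by (rule T_module)
  show ?thesis
    unfolding star_relations_def Let_def by auto
qed

lemma W_submodule: "submodule W K T"
  by (rule lin_span_submodule[OF T_module star_relations_closed])

lemma Q_module: "module K Q"
  unfolding star_space_def Let_def by (rule quotient_space_module[OF T_module W_submodule])

lemma coset_T_linear: "linear_map K T Q (\<lambda>x. W +>\<^bsub>T\<^esub> x)"
  unfolding star_space_def Let_def by (rule coset_linear_map[OF T_module W_submodule])

lemma star_coset: "W +>\<^bsub>T\<^esub> t m n = s m n"
  by (simp add: star_def Let_def)

lemma star_bilinear: "bilinear_map K M N Q s"
  using linear_map_bilinear_map[OF coset_T_linear pure_tensor_bilinear[OF M.module_L N.module_L]]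
  by (simp add: star_coset)

lemma star_closed [simp]: "\<lbrakk>m \<in> carrier M; n \<in> carrier N\<rbrakk> \<Longrightarrow> s m n \<in> carrier Q"
  by (rule bilinear_map_closed[OF star_bilinear])

lemma star_span: "lin_span K Q {s m n | m n. m \<in> carrier M \<and> n \<in> carrier N} = carrier Q"
proof -
  let ?S = "{t m n | m n. m \<in> carrier M \<and> n \<in> carrier N}"
  have "lin_span K Q ((\<lambda>x. W +>\<^bsub>T\<^esub> x) ` ?S) = carrier Q"
  proof (rule linear_map_span_image[OF T_module Q_module coset_T_linear _
        tensor_space_span[OF M.module_L N.module_L]])
    show "?S \<subseteq> carrier T" using t_closed by blast
    show "(\<lambda>x. W +>\<^bsub>T\<^esub> x) ` carrier T = carrier Q"
      unfolding star_space_def Let_def by (rule quotient_space_carrier[symmetric])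
  qed
  moreover have image: "f ` {g m n | m n. P m n} = {f (g m n) | m n. P m n}" for f g and P :: "'m \<Rightarrow> 'n \<Rightarrow> bool"
    by blast
  ultimately show ?thesis by (simp only: image star_coset)
qed

text \<open>Together with linearity of the quotient map, this turns the five families of relations
  between pure tensors into the identities between elements \<open>s m n\<close> that
  follow.\<close>

lemma coset_relation_zero:
  "r \<in> star_relations K M N aM aN \<Longrightarrow> W +>\<^bsub>T\<^esub> r = \<zero>\<^bsub>Q\<^esub>"
  unfolding star_space_def Let_def
  by (rule quotient_space_coset_zero[OF T_module W_submodule subsetD[OF lin_span_superset]])

lemma star_relation_1:
  assumes "m \<in> carrier M" "m' \<in> carrier M" "n \<in> carrier N"
  shows "s \<lbrakk>m, m'\<rbrakk>\<^bsub>M\<^esub> (twist N n) \<ominus>\<^bsub>Q\<^esub> s (twist M m) (aM m' n) \<oplus>\<^bsub>Q\<^esub> s (twist M m') (aM m n) = \<zero>\<^bsub>Q\<^esub>"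
proof -
  interpret T: module K T by (rule T_module)
  have "t \<lbrakk>m, m'\<rbrakk>\<^bsub>M\<^esub> (twist N n) \<ominus>\<^bsub>T\<^esub> t (twist M m) (aM m' n) \<oplus>\<^bsub>T\<^esub> t (twist M m') (aM m n)
      \<in> star_relations K M N aM aN"
    using assms unfolding star_relations_def Let_def by blast
  from coset_relation_zero[OF this] show ?thesis
    using assms by (simp add: linear_map_add[OF coset_T_linear] star_coset
        linear_map_diff[OF T_module Q_module coset_T_linear])
qed

lemma star_relation_2:
  assumes "m \<in> carrier M" "n \<in> carrier N" "n' \<in> carrier N"
  shows "s (twist M m) \<lbrakk>n, n'\<rbrakk>\<^bsub>N\<^esub> \<ominus>\<^bsub>Q\<^esub> s (aN n' m) (twist N n) \<oplus>\<^bsub>Q\<^esub> s (aN n m) (twist N n') = \<zero>\<^bsub>Q\<^esub>"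
proof -
  interpret T: module K T by (rule T_module)
  have "t (twist M m) \<lbrakk>n, n'\<rbrakk>\<^bsub>N\<^esub> \<ominus>\<^bsub>T\<^esub> t (aN n' m) (twist N n) \<oplus>\<^bsub>T\<^esub> t (aN n m) (twist N n')
      \<in> star_relations K M N aM aN"
    using assms unfolding star_relations_def Let_def by blast
  from coset_relation_zero[OF this] show ?thesis
    using assms by (simp add: linear_map_add[OF coset_T_linear] star_coset
        linear_map_diff[OF T_module Q_module coset_T_linear])
qed

lemma star_relation_3:
  assumes "m \<in> carrier M" "n \<in> carrier N"
  shows "s (aN n m) (aM m n) = \<zero>\<^bsub>Q\<^esub>"
proof -
  have "t (aN n m) (aM m n) \<in> star_relations K M N aM aN"
    using assms unfolding star_relations_def Let_def by blast
  from coset_relation_zero[OF this] show ?thesis by (simp add: star_coset)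
qed

lemma star_relation_4:
  assumes "m \<in> carrier M" "m' \<in> carrier M" "n \<in> carrier N" "n' \<in> carrier N"
  shows "s (aN n m) (aM m' n') \<oplus>\<^bsub>Q\<^esub> s (aN n' m') (aM m n) = \<zero>\<^bsub>Q\<^esub>"
proof -
  have "t (aN n m) (aM m' n') \<oplus>\<^bsub>T\<^esub> t (aN n' m') (aM m n) \<in> star_relations K M N aM aN"
    using assms unfolding star_relations_def Let_def by blast
  from coset_relation_zero[OF this] show ?thesis
    using assms by (simp add: linear_map_add[OF coset_T_linear] star_coset)
qed

lemma star_relation_5:
  assumes "m \<in> carrier M" "m' \<in> carrier M" "m'' \<in> carrier M"
    and "n \<in> carrier N" "n' \<in> carrier N" "n'' \<in> carrier N"
  shows "s \<lbrakk>aN n m, aN n' m'\<rbrakk>\<^bsub>M\<^esub> (twist N (aM m'' n''))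
    \<oplus>\<^bsub>Q\<^esub> s \<lbrakk>aN n' m', aN n'' m''\<rbrakk>\<^bsub>M\<^esub> (twist N (aM m n))
    \<oplus>\<^bsub>Q\<^esub> s \<lbrakk>aN n'' m'', aN n m\<rbrakk>\<^bsub>M\<^esub> (twist N (aM m' n')) = \<zero>\<^bsub>Q\<^esub>"
proof -
  interpret T: module K T by (rule T_module)
  have "t \<lbrakk>aN n m, aN n' m'\<rbrakk>\<^bsub>M\<^esub> (twist N (aM m'' n''))
    \<oplus>\<^bsub>T\<^esub> t \<lbrakk>aN n' m', aN n'' m''\<rbrakk>\<^bsub>M\<^esub> (twist N (aM m n))
    \<oplus>\<^bsub>T\<^esub> t \<lbrakk>aN n'' m'', aN n m\<rbrakk>\<^bsub>M\<^esub> (twist N (aM m' n')) \<in> star_relations K M N aM aN"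
    \<comment> \<open>The unions are nested to the left, so \<open>UnI2\<close> selects the fifth
      family at once.\<close>
    unfolding star_relations_def Let_def by (rule UnI2) (use assms in blast)
  from coset_relation_zero[OF this] show ?thesis
    using assms by (simp add: linear_map_add[OF coset_T_linear] star_coset)
qed

text \<open>The universal property of the quotient: the linear map on the tensor space induced by
  \<open>b\<close> kills the five families by assumption, hence also their span
  \<open>W\<close>.\<close>

lemma star_lift:
  assumes Z: "module K Z" and b: "bilinear_map K M N Z b"
    and 1: "\<And>m m' n. \<lbrakk>m \<in> carrier M; m' \<in> carrier M; n \<in> carrier N\<rbrakk> \<Longrightarrow>
      b \<lbrakk>m, m'\<rbrakk>\<^bsub>M\<^esub> (twist N n) \<ominus>\<^bsub>Z\<^esub> b (twist M m) (aM m' n) \<oplus>\<^bsub>Z\<^esub> b (twist M m') (aM m n) = \<zero>\<^bsub>Z\<^esub>"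
    and 2: "\<And>m n n'. \<lbrakk>m \<in> carrier M; n \<in> carrier N; n' \<in> carrier N\<rbrakk> \<Longrightarrow>
      b (twist M m) \<lbrakk>n, n'\<rbrakk>\<^bsub>N\<^esub> \<ominus>\<^bsub>Z\<^esub> b (aN n' m) (twist N n) \<oplus>\<^bsub>Z\<^esub> b (aN n m) (twist N n') = \<zero>\<^bsub>Z\<^esub>"
    and 3: "\<And>m n. \<lbrakk>m \<in> carrier M; n \<in> carrier N\<rbrakk> \<Longrightarrow> b (aN n m) (aM m n) = \<zero>\<^bsub>Z\<^esub>"
    and 4: "\<And>m m' n n'. \<lbrakk>m \<in> carrier M; m' \<in> carrier M; n \<in> carrier N; n' \<in> carrier N\<rbrakk> \<Longrightarrow>
      b (aN n m) (aM m' n') \<oplus>\<^bsub>Z\<^esub> b (aN n' m') (aM m n) = \<zero>\<^bsub>Z\<^esub>"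
    and 5: "\<And>m m' m'' n n' n''. \<lbrakk>m \<in> carrier M; m' \<in> carrier M; m'' \<in> carrier M;
        n \<in> carrier N; n' \<in> carrier N; n'' \<in> carrier N\<rbrakk> \<Longrightarrow>
      b \<lbrakk>aN n m, aN n' m'\<rbrakk>\<^bsub>M\<^esub> (twist N (aM m'' n''))
        \<oplus>\<^bsub>Z\<^esub> b \<lbrakk>aN n' m', aN n'' m''\<rbrakk>\<^bsub>M\<^esub> (twist N (aM m n))
        \<oplus>\<^bsub>Z\<^esub> b \<lbrakk>aN n'' m'', aN n m\<rbrakk>\<^bsub>M\<^esub> (twist N (aM m' n')) = \<zero>\<^bsub>Z\<^esub>"
  shows "\<exists>f. linear_map K Q Z f \<and> (\<forall>m\<in>carrier M. \<forall>n\<in>carrier N. f (s m n) = b m n)"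
proof -
  interpret T: module K T by (rule T_module)
  obtain g where g: "linear_map K T Z g"
    and gb: "\<And>m n. \<lbrakk>m \<in> carrier M; n \<in> carrier N\<rbrakk> \<Longrightarrow> g (t m n) = b m n"
    using tensor_space_lift[OF M.module_L N.module_L Z b] by blast
  have "g r = \<zero>\<^bsub>Z\<^esub>" if "r \<in> star_relations K M N aM aN" for r
    using that unfolding star_relations_def Let_def
    by (elim UnE)
      (clarsimp, simp add: linear_map_add[OF g] linear_map_diff[OF T_module Z g] gb 1 2 3 4 5)+
  then have "g w = \<zero>\<^bsub>Z\<^esub>" if "w \<in> W" for w
    using linear_map_span_zero[OF T_module Z g star_relations_closed] that by blast
  from quotient_space_lift[OF T_module W_submodule Z g this] obtain f
    where "linear_map K Q Z f" and fg: "\<And>x. x \<in> carrier T \<Longrightarrow> f (W +>\<^bsub>T\<^esub> x) = g x"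
    unfolding star_space_def Let_def by blast
  moreover have "f (s m n) = b m n" if "m \<in> carrier M" "n \<in> carrier N" for m n
    using that fg[of "t m n"] by (simp add: star_coset gb)
  ultimately show ?thesis by blast
qed

section \<open>The two projections and the existence of the operations\<close>

lemma project_M:
  "\<exists>f. linear_map K Q M f \<and> (\<forall>m\<in>carrier M. \<forall>n\<in>carrier N. f (s m n) = aN n m)"
  by (rule star_lift[OF M.module_L bilinear_map_flip[OF hom_action_bilinear[OF action_N]]])
    (rule kill_relation_1 kill_relation_2 kill_relation_3 kill_relation_4 kill_relation_5_M; assumption)+

text \<open>Under the exchange of \<open>M\<close> and \<open>N\<close> the first two families of
  relations trade places, while the third and the fourth are preserved up to renaming.\<close>

lemma project_N:
  "\<exists>f. linear_map K Q N f \<and> (\<forall>m\<in>carrier M. \<forall>n\<in>carrier N. f (s m n) = aM m n)"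
proof -
  interpret sw: compatible_hom_lie_algebras K N M aN aM by (rule swap)
  show ?thesis
  proof (rule star_lift[OF N.module_L hom_action_bilinear[OF action_M]])
    fix m m' n n' assume "m \<in> carrier M" "m' \<in> carrier M" "n \<in> carrier N" "n' \<in> carrier N"
    then show "aM (aN n m) (aM m' n') \<oplus>\<^bsub>N\<^esub> aM (aN n' m') (aM m n) = \<zero>\<^bsub>N\<^esub>"
      by (intro sw.kill_relation_4)
  qed (rule sw.kill_relation_1 sw.kill_relation_2 sw.kill_relation_3 kill_relation_5_N; assumption)+
qed

text \<open>Twisting a relation gives the relation of the same family for the twisted elements,
  because the twisting maps commute with brackets and actions. In the fifth family the instance must
  be rewritten too, since it contains twisted actions itself.\<close>

lemma star_twist_exists:
  "\<exists>f. linear_map K Q Q f \<and>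
    (\<forall>m\<in>carrier M. \<forall>n\<in>carrier N. f (s m n) = s (twist M m) (twist N n))"
proof (rule star_lift[OF Q_module bilinear_map_compose[OF star_bilinear M.twist_linear N.twist_linear]])
qed (simp_all add: M.multiplicative N.multiplicative hom_action_twist[OF action_M]
    hom_action_twist[OF action_N] star_relation_1 star_relation_2 star_relation_3 star_relation_4,
    use star_relation_5[of "twist M _" "twist M _" "twist M _" "twist N _" "twist N _" "twist N _"]
      in \<open>simp add: hom_action_twist[OF action_M] hom_action_twist[OF action_N]\<close>)

text \<open>With the projections \<open>p\<close> and \<open>q\<close> at hand, well-definedness in
  both arguments comes for free: the bracket is a composition of maps already defined on
  \<open>Q\<close>.\<close>

lemma star_bracket_exists:
  "\<exists>b. bilinear_map K Q Q Q b \<and>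
    (\<forall>m\<in>carrier M. \<forall>n\<in>carrier N. \<forall>m'\<in>carrier M. \<forall>n'\<in>carrier N.
      b (s m n) (s m' n') = \<ominus>\<^bsub>Q\<^esub> s (aN n m) (aM m' n'))"
proof -
  obtain p q where p: "linear_map K Q M p" "\<forall>m\<in>carrier M. \<forall>n\<in>carrier N. p (s m n) = aN n m"
    and q: "linear_map K Q N q" "\<forall>m\<in>carrier M. \<forall>n\<in>carrier N. q (s m n) = aM m n"
    using project_M project_N by blast
  have "bilinear_map K Q Q Q (\<lambda>x y. s (p x) (q y))"
    by (rule bilinear_map_compose[OF star_bilinear p(1) q(1)])
  then have "bilinear_map K Q Q Q (\<lambda>x y. \<ominus>\<^bsub>Q\<^esub> s (p x) (q y))"
    by (simp add: bilinear_map_def linear_map_uminus[OF Q_module])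
  then show ?thesis
    by (rule exI[of _ "\<lambda>x y. \<ominus>\<^bsub>Q\<^esub> s (p x) (q y)", OF conjI]) (simp add: p(2) q(2))
qed

text \<open>The operations are chosen by \<open>SOME\<close>; the existence results guarantee that
  the choice has the prescribed properties.\<close>

lemma star_twist_linear: "linear_map K Q Q (star_twist K M N aM aN)"
  and star_twist_star: "\<lbrakk>m \<in> carrier M; n \<in> carrier N\<rbrakk> \<Longrightarrow>
    star_twist K M N aM aN (s m n) = s (twist M m) (twist N n)"
  using someI_ex[OF star_twist_exists] by (simp_all add: star_twist_def Let_def)

lemma star_bracket_bilinear: "bilinear_map K Q Q Q (star_bracket K M N aM aN)"
  and star_bracket_star:
    "\<lbrakk>m \<in> carrier M; n \<in> carrier N; m' \<in> carrier M; n' \<in> carrier N\<rbrakk> \<Longrightarrow>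
      star_bracket K M N aM aN (s m n) (s m' n') = \<ominus>\<^bsub>Q\<^esub> s (aN n m) (aM m' n')"
  using someI_ex[OF star_bracket_exists] by (simp_all add: star_bracket_def Let_def)

section \<open>The Hom-Lie axioms, checked on the generators \<open>s m n\<close>\<close>

lemma linear_map_eq_on_star:
  assumes "linear_map K Q Z f" and "linear_map K Q Z g" and Z: "module K Z"
    and "\<And>m n. \<lbrakk>m \<in> carrier M; n \<in> carrier N\<rbrakk> \<Longrightarrow> f (s m n) = g (s m n)" and "x \<in> carrier Q"
  shows "f x = g x"
  by (rule linear_map_eq_on_span[OF Q_module Z assms(1,2) _ star_span]) (use assms in auto)

text \<open>Both sides are linear in \<open>x\<close> for fixed \<open>y\<close>, and then in
  \<open>y\<close> for fixed \<open>x = s m n\<close>. On generators the claim is the fourth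
  relation.\<close>

lemma star_bracket_skew:
  assumes x: "x \<in> carrier Q" and y: "y \<in> carrier Q"
  shows "star_bracket K M N aM aN x y = \<ominus>\<^bsub>Q\<^esub> star_bracket K M N aM aN y x" (is "?b x y = _")
proof -
  interpret Q: module K Q by (rule Q_module)
  note b = star_bracket_bilinear and u = linear_map_uminus[OF Q_module]
  show ?thesis
  proof (rule linear_map_eq_on_star[OF bilinear_map_left[OF b y] u[OF bilinear_map_right[OF b y]] Q_module _ x])
    fix m n assume m: "m \<in> carrier M" and n: "n \<in> carrier N"
    then have mn: "s m n \<in> carrier Q" by simp
    show "?b (s m n) y = \<ominus>\<^bsub>Q\<^esub> ?b y (s m n)"
    proof (rule linear_map_eq_on_star[OF bilinear_map_right[OF b mn] u[OF bilinear_map_left[OF b mn]] Q_module _ y])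
      fix m' n' assume m': "m' \<in> carrier M" and n': "n' \<in> carrier N"
      then show "?b (s m n) (s m' n') = \<ominus>\<^bsub>Q\<^esub> ?b (s m' n') (s m n)"
        using m n star_relation_4[OF m m' n n']
          Q.minus_equality[of "s (aN n m) (aM m' n')" "s (aN n' m') (aM m n)"]
        by (simp add: star_bracket_star)
    qed
  qed
qed

text \<open>Both sides are bilinear in \<open>x\<close> and \<open>y\<close>. On generators they
  agree because the twisting maps commute with the actions.\<close>

lemma star_multiplicative:
  assumes x: "x \<in> carrier Q" and y: "y \<in> carrier Q"
  shows "star_twist K M N aM aN (star_bracket K M N aM aN x y) =
    star_bracket K M N aM aN (star_twist K M N aM aN x) (star_twist K M N aM aN y)"
proof -
  let ?b = "star_bracket K M N aM aN" and ?f = "star_twist K M N aM aN"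
  note f = star_twist_linear and b = linear_map_bilinear_map[OF star_twist_linear star_bracket_bilinear]
    and b' = bilinear_map_compose[OF star_bracket_bilinear star_twist_linear star_twist_linear]
  show ?thesis
  proof (rule linear_map_eq_on_star[OF bilinear_map_left[OF b y] bilinear_map_left[OF b' y] Q_module _ x])
    fix m n assume m: "m \<in> carrier M" and n: "n \<in> carrier N"
    then have mn: "s m n \<in> carrier Q" by simp
    show "?f (?b (s m n) y) = ?b (?f (s m n)) (?f y)"
    proof (rule linear_map_eq_on_star[OF bilinear_map_right[OF b mn] bilinear_map_right[OF b' mn] Q_module _ y])
      fix m' n' assume "m' \<in> carrier M" and "n' \<in> carrier N"
      then show "?f (?b (s m n) (s m' n')) = ?b (?f (s m n)) (?f (s m' n'))"
        using m n by (simp add: star_bracket_star star_twist_star linear_map_minus[OF Q_module Q_module f]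
            hom_action_twist[OF action_M] hom_action_twist[OF action_N])
    qed
  qed
qed

text \<open>Skew-symmetry moves the inner bracket into the first argument. There the action on
  \<open>M\<close> becomes a bracket in \<open>M\<close>, which is the shape of a term in the fifth
  relation.\<close>

lemma star_jacobi_star:
  assumes "m \<in> carrier M" "m' \<in> carrier M" "m'' \<in> carrier M"
    and "n \<in> carrier N" "n' \<in> carrier N" "n'' \<in> carrier N"
  shows "star_bracket K M N aM aN (star_twist K M N aM aN (s m n))
      (star_bracket K M N aM aN (s m' n') (s m'' n'')) =
    \<ominus>\<^bsub>Q\<^esub> s \<lbrakk>aN n' m', aN n'' m''\<rbrakk>\<^bsub>M\<^esub> (twist N (aM m n))"
proof -
  let ?b = "star_bracket K M N aM aN" and ?f = "star_twist K M N aM aN"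
  interpret Q: module K Q by (rule Q_module)
  let ?a = "aN n' m'" and ?b'' = "aM m'' n''"
  have cl: "s (twist M m) (twist N n) \<in> carrier Q" "s ?a ?b'' \<in> carrier Q"
    using assms by simp_all
  have "?b (?f (s m n)) (?b (s m' n') (s m'' n'')) = \<ominus>\<^bsub>Q\<^esub> ?b (s (twist M m) (twist N n)) (s ?a ?b'')"
    using assms cl
    by (simp add: star_twist_star star_bracket_star
        linear_map_minus[OF Q_module Q_module bilinear_map_right[OF star_bracket_bilinear]])
  also have "\<dots> = ?b (s ?a ?b'') (s (twist M m) (twist N n))"
    using star_bracket_skew[OF cl(2,1)] by simp
  also have "\<dots> = \<ominus>\<^bsub>Q\<^esub> s \<lbrakk>aN n' m', aN n'' m''\<rbrakk>\<^bsub>M\<^esub> (twist N (aM m n))"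
    using assms by (simp add: star_bracket_star bracket_actions hom_action_twist[OF action_M])
  finally show ?thesis .
qed

lemma star_jacobi:
  assumes "x \<in> carrier Q" "y \<in> carrier Q" "z \<in> carrier Q"
  shows "star_bracket K M N aM aN (star_twist K M N aM aN x) (star_bracket K M N aM aN y z)
    \<oplus>\<^bsub>Q\<^esub> star_bracket K M N aM aN (star_twist K M N aM aN z) (star_bracket K M N aM aN x y)
    \<oplus>\<^bsub>Q\<^esub> star_bracket K M N aM aN (star_twist K M N aM aN y) (star_bracket K M N aM aN z x) = \<zero>\<^bsub>Q\<^esub>"
proof -
  interpret Q: module K Q by (rule Q_module)
  let ?b = "star_bracket K M N aM aN" and ?f = "star_twist K M N aM aN"
  note b = star_bracket_bilinear and f = star_twist_linear
  define J where "J x y z = ?b (?f x) (?b y z) \<oplus>\<^bsub>Q\<^esub> ?b (?f z) (?b x y) \<oplus>\<^bsub>Q\<^esub> ?b (?f y) (?b z x)" for x y z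
  note cl [simp] = bilinear_map_closed[OF b] linear_map_closed[OF f]
  \<comment> \<open>Because \<open>J\<close> is invariant under cyclic shifts, linearity in the
    first argument is enough: each argument is rotated into first place and there reduced to a
    generator.\<close>
  have cyclic: "J x y z = J y z x" if "x \<in> carrier Q" "y \<in> carrier Q" "z \<in> carrier Q" for x y z
    using that by (simp add: J_def Q.a_ac)
  have lin: "linear_map K Q Q (\<lambda>x. J x y z)" if y: "y \<in> carrier Q" and z: "z \<in> carrier Q" for y z
  proof -
    have "linear_map K Q Q (\<lambda>x. ?b (?f x) (?b y z))"
      by (rule linear_map_compose[OF f bilinear_map_left[OF b cl(1)[OF y z]]])
    moreover have "linear_map K Q Q (\<lambda>x. ?b (?f z) (?b x y))"
      by (rule linear_map_compose[OF bilinear_map_left[OF b y] bilinear_map_right[OF b cl(2)[OF z]]])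
    moreover have "linear_map K Q Q (\<lambda>x. ?b (?f y) (?b z x))"
      by (rule linear_map_compose[OF bilinear_map_right[OF b z] bilinear_map_right[OF b cl(2)[OF y]]])
    ultimately show ?thesis
      unfolding J_def by (intro linear_map_sum[OF Q_module])
  qed
  have step: "J x y z = \<zero>\<^bsub>Q\<^esub>"
    if "x \<in> carrier Q" "y \<in> carrier Q" "z \<in> carrier Q"
      and "\<And>m n. \<lbrakk>m \<in> carrier M; n \<in> carrier N\<rbrakk> \<Longrightarrow> J (s m n) y z = \<zero>\<^bsub>Q\<^esub>" for x y z
    using linear_map_eq_on_star[OF lin[OF that(2,3)] linear_map_const_zero[OF Q_module] Q_module that(4,1)] .
  have pure: "J (s m n) (s m' n') (s m'' n'') = \<zero>\<^bsub>Q\<^esub>"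
    if "m \<in> carrier M" "m' \<in> carrier M" "m'' \<in> carrier M"
      and "n \<in> carrier N" "n' \<in> carrier N" "n'' \<in> carrier N" for m n m' n' m'' n''
  proof -
    \<comment> \<open>Each summand is the negative of one term of the fifth relation; only the order
      of the summands differs.\<close>
    have "J (s m n) (s m' n') (s m'' n'') = \<ominus>\<^bsub>Q\<^esub> (s \<lbrakk>aN n m, aN n' m'\<rbrakk>\<^bsub>M\<^esub> (twist N (aM m'' n''))
      \<oplus>\<^bsub>Q\<^esub> s \<lbrakk>aN n' m', aN n'' m''\<rbrakk>\<^bsub>M\<^esub> (twist N (aM m n))
      \<oplus>\<^bsub>Q\<^esub> s \<lbrakk>aN n'' m'', aN n m\<rbrakk>\<^bsub>M\<^esub> (twist N (aM m' n')))"
      using that by (simp add: J_def star_jacobi_star Q.minus_add Q.a_ac)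
    then show ?thesis using that by (simp add: star_relation_5)
  qed
  have 1: "J x (s m' n') (s m'' n'') = \<zero>\<^bsub>Q\<^esub>"
    if "x \<in> carrier Q" "m' \<in> carrier M" "m'' \<in> carrier M" "n' \<in> carrier N" "n'' \<in> carrier N"
    for x m' n' m'' n''
    by (rule step[OF that(1) _ _ pure]) (use that in simp_all)
  have 2: "J x y (s m'' n'') = \<zero>\<^bsub>Q\<^esub>"
    if "x \<in> carrier Q" "y \<in> carrier Q" "m'' \<in> carrier M" "n'' \<in> carrier N" for x y m'' n''
  proof -
    have "J y (s m'' n'') x = \<zero>\<^bsub>Q\<^esub>"
    proof (rule step)
      fix m n assume "m \<in> carrier M" "n \<in> carrier N"
      then show "J (s m n) (s m'' n'') x = \<zero>\<^bsub>Q\<^esub>"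
        using that 1[of x m m'' n n''] cyclic[of x "s m n" "s m'' n''"] by simp
    qed (use that in auto)
    then show ?thesis using that cyclic[of x y "s m'' n''"] by simp
  qed
  \<comment> \<open>Now \<open>z\<close> is the last argument to be reduced: with a generator in its
    place, a shift leads to the case \<open>2\<close>.\<close>
  have "J z x y = \<zero>\<^bsub>Q\<^esub>"
  proof (rule step)
    fix m n assume "m \<in> carrier M" "n \<in> carrier N"
    then show "J (s m n) x y = \<zero>\<^bsub>Q\<^esub>"
      using assms 2[of x y m n] cyclic[of "s m n" x y] by simp
  qed (use assms in auto)
  then have "J x y z = \<zero>\<^bsub>Q\<^esub>" using assms cyclic[of z x y] by simp
  then show ?thesis by (simp add: J_def)
qed

section \<open>Assembling the Hom-Lie algebra, and its perfectness\<close>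

abbreviation "P \<equiv> star_product K M N aM aN"

lemma star_product_fields:
  "carrier P = carrier Q" "zero P = zero Q" "add P = add Q" "smult P = smult Q"
  "bracket P = star_bracket K M N aM aN" "twist P = star_twist K M N aM aN"
  by (simp_all add: star_product_def Let_def)

lemma star_product_uminus: "\<ominus>\<^bsub>P\<^esub> x = \<ominus>\<^bsub>Q\<^esub> x"
  by (simp add: a_inv_def m_inv_def star_product_fields)

lemma star_product_hom_lie: "hom_lie_algebra K P"
proof (intro hom_lie_algebra.intro hom_lie_algebra_axioms.intro)
  show "field K" by (rule M.field_axioms)
  show "module K P" by (rule module_fields_cong[OF Q_module star_product_fields(1-4)])
  show "bilinear_map K P P P (bracket P)"
    using star_bracket_bilinear by (simp add: bilinear_map_def linear_map_def star_product_fields)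
  show "linear_map K P P (twist P)"
    using star_twist_linear by (simp add: linear_map_def star_product_fields)
qed (simp_all add: star_product_fields star_product_uminus star_bracket_skew[symmetric]
    star_jacobi star_multiplicative)

lemma star_product_perfect:
  assumes M: "action_span K N M aN = carrier M" and N: "action_span K M N aM = carrier N"
  shows "perfect K P"
proof -
  interpret Q: module K Q by (rule Q_module)
  let ?b = "star_bracket K M N aM aN"
  let ?B = "{?b x y | x y. x \<in> carrier Q \<and> y \<in> carrier Q}"
  have B: "?B \<subseteq> carrier Q" using bilinear_map_closed[OF star_bracket_bilinear] by blast
  have H: "submodule (lin_span K Q ?B) K Q" by (rule lin_span_submodule[OF Q_module B])
  \<comment> \<open>Since \<open>s\<close> is bilinear and the actions span \<open>M\<close> and
    \<open>N\<close>, it suffices to treat \<open>a = aN n m\<close> and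
    \<open>c = aM m' n'\<close>. Then \<open>s a c\<close> is minus the bracket of
    \<open>s m n\<close> and \<open>s m' n'\<close>.\<close>
  have "s a c \<in> lin_span K Q ?B" if "a \<in> carrier M" "c \<in> carrier N" for a c
  proof (rule bilinear_map_span_into[OF M.module_L N.module_L Q_module star_bilinear H _
        M[unfolded action_span_def] _ N[unfolded action_span_def] _ that])
    fix x y assume "x \<in> {aN n m |n m. n \<in> carrier N \<and> m \<in> carrier M}"
      and "y \<in> {aM m n |m n. m \<in> carrier M \<and> n \<in> carrier N}"
    then obtain m n m' n' where *: "m \<in> carrier M" "n \<in> carrier N" "m' \<in> carrier M" "n' \<in> carrier N"
      and xy: "x = aN n m" "y = aM m' n'" by blast
    have "?b (s m n) (s m' n') \<in> lin_span K Q ?B"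
      using lin_span_superset[of ?B K Q] star_closed * by blast
    from Q.submoduleE(3)[OF H this] show "s x y \<in> lin_span K Q ?B"
      using * xy by (simp add: star_bracket_star)
  qed auto
  then have "{s m n | m n. m \<in> carrier M \<and> n \<in> carrier N} \<subseteq> lin_span K Q ?B"
    by blast
  from lin_span_minimal[OF H this] have "carrier Q \<subseteq> lin_span K Q ?B"
    by (simp only: star_span)
  moreover have "lin_span K Q ?B \<subseteq> carrier Q"
    by (rule lin_span_minimal[OF Q.carrier_is_submodule B])
  ultimately show ?thesis
    by (simp add: perfect_def lin_span_fields_cong[OF star_product_fields(1-4)] star_product_fields)
qed

end

theorem proposition6p1:
  fixes K :: "('k, 'z) ring_scheme"
    and M :: "('k, 'm, 'p) hom_lie_scheme"
    and N :: "('k, 'n, 'q) hom_lie_scheme"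
    and aM :: "'m \<Rightarrow> 'n \<Rightarrow> 'n"
    and aN :: "'n \<Rightarrow> 'm \<Rightarrow> 'm"
  assumes "hom_lie_algebra K M" and "hom_lie_algebra K N"
    and char_not_2_or_alternating:
      "\<one>\<^bsub>K\<^esub> \<oplus>\<^bsub>K\<^esub> \<one>\<^bsub>K\<^esub> \<noteq> \<zero>\<^bsub>K\<^esub> \<or>
       (\<forall>x\<in>carrier M. \<lbrakk>x, x\<rbrakk>\<^bsub>M\<^esub> = \<zero>\<^bsub>M\<^esub>) \<and> (\<forall>x\<in>carrier N. \<lbrakk>x, x\<rbrakk>\<^bsub>N\<^esub> = \<zero>\<^bsub>N\<^esub>)"
    and "perfect K M" and "perfect K N"
    and "hom_action K M N aM" and "hom_action K N M aN"
    and "compatible_actions M N aM aN"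
    and "action_span K N M aN = carrier M"
    and "action_span K M N aM = carrier N"
  shows "hom_lie_algebra K (star_product K M N aM aN) \<and>
         perfect K (star_product K M N aM aN)"
proof -
  interpret M: hom_lie_algebra K M by (fact assms(1))
  interpret N: hom_lie_algebra K N by (fact assms(2))
  \<comment> \<open>The alternating laws are what makes the projections kill the third relation, and
    thereby the bracket well defined.\<close>
  interpret compatible_hom_lie_algebras K M N aM aN
  proof
    show "\<lbrakk>x, x\<rbrakk>\<^bsub>M\<^esub> = \<zero>\<^bsub>M\<^esub>" if "x \<in> carrier M" for x
      using char_not_2_or_alternating M.bracket_self_zero that by blast
    show "\<lbrakk>y, y\<rbrakk>\<^bsub>N\<^esub> = \<zero>\<^bsub>N\<^esub>" if "y \<in> carrier N" for y
      using char_not_2_or_alternating N.bracket_self_zero that by blast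
  qed (fact assms)+
  show ?thesis
    using star_product_hom_lie star_product_perfect[OF assms(9,10)] ..
qed

end
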